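(* Let $N\ge2$ and let $\mathbf 1_N$ be the $N\times N$ matrix all of whose entries are $1$. The action $\varphi:O_N\to C(\mathbb G_{\mathbf 1_N}^\infty)\otimes O_N$, $\varphi(S_i)=\sum_{j=1}^N u_{i,j}\otimes S_j$, of the compact quantum group $\mathbb G_{\mathbf 1_N}^\infty$ on the Cuntz algebra $O_N$ is ergodic, i.e. $\{a\in O_N:\varphi(a)=1\otimes a\}=\mathbb C1$.
   Context: $O_N=O_{\mathbf 1_N}$ is the Cuntz algebra, the universal $C^*$-algebra generated by isometries $S_1,\dots,S_N$ with $\sum_jS_jS_j^*=1$. A magic unitary is a square matrix of self-adjoint projections in a unital $C^*$-algebra such that each row and each column sums to $1$. $C(\mathbb G_{\mathbf 1_N}^\infty)$ is the universal unital $C^*$-algebra generated by partial isometries $(u_{i,j})_{1\le i,j\le N}$ such that, with $p_{i,j}=u_{i,j}u_{i,j}^*$ and $q_{i,j}=u_{i,j}^*u_{i,j}$: (I) $p=(p_{i,j})$ and $q=(q_{i,j})$ are magic unitaries preserving the Perron--Frobenius eigenvector of $\mathbf 1_N$ (the constant vector $\vec u$: $p\vec u=\vec u1=q\vec u$); (II) $\mathbf 1_Np=q\mathbf 1_N$; (III) for all $n\in\mathbb N$ and all words $\alpha,\beta\in\{1,\dots,N\}^n$ the element $u_{\alpha_1,\beta_1}\cdots u_{\alpha_n,\beta_n}$ is a partial isometry. (For this matrix, the preservation of the constant vector and (II) are automatic.) It is a compact quantum group with coproduct $u_{i,j}\mapsto\sum_ku_{i,k}\otimes u_{k,j}$. Tensor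 products are minimal. *)

theory Defs
  imports "HOL-Analysis.Analysis" "HOL-Library.Poly_Mapping"
begin

section \<open>Unital C*-algebras\<close>

text \<open>The zero algebra is excluded, since \<open>norm 1 = 1\<close> holds in \<^class>\<open>real_normed_algebra_1\<close>.\<close>

class cstar_algebra = real_normed_algebra_1 + banach +
  fixes scaleC :: "complex \<Rightarrow> 'a \<Rightarrow> 'a" (infixr "*\<^sub>C" 75)
    and star :: "'a \<Rightarrow> 'a"
  assumes scaleC_of_real: "complex_of_real r *\<^sub>C x = r *\<^sub>R x"
    and scaleC_add_right: "c *\<^sub>C (x + y) = c *\<^sub>C x + c *\<^sub>C y"
    and scaleC_add_left: "(c + d) *\<^sub>C x = c *\<^sub>C x + d *\<^sub>C x"
    and scaleC_scaleC: "c *\<^sub>C (d *\<^sub>C x) = (c * d) *\<^sub>C x"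
    and mult_scaleC_left: "(c *\<^sub>C x) * y = c *\<^sub>C (x * y)"
    and mult_scaleC_right: "x * (c *\<^sub>C y) = c *\<^sub>C (x * y)"
    and norm_scaleC: "norm (c *\<^sub>C x) = cmod c * norm x"
    and star_add: "star (x + y) = star x + star y"
    and star_scaleC: "star (c *\<^sub>C x) = cnj c *\<^sub>C star x"
    and star_mult: "star (x * y) = star y * star x"
    and star_star: "star (star x) = x"
    and norm_star_mult_self: "norm (star x * x) = (norm x)\<^sup>2"

definition unital_star_hom :: "('a::cstar_algebra \<Rightarrow> 'b::cstar_algebra) \<Rightarrow> bool" where
  "unital_star_hom f \<longleftrightarrow>
     (\<forall>x y. f (x + y) = f x + f y) \<and> (\<forall>c x. f (c *\<^sub>C x) = c *\<^sub>C f x) \<and>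
     (\<forall>x y. f (x * y) = f x * f y) \<and> (\<forall>x. f (star x) = star (f x)) \<and> f 1 = 1"


section \<open>The free unital *-algebra on a set of generators\<close>

text \<open>The letter \<open>(x, False)\<close> stands for the generator \<open>x\<close> and \<open>(x, True)\<close> for its adjoint.
  A *-polynomial is a finitely supported function from words to coefficients; the ring
  structure of \<^type>\<open>poly_mapping\<close> is the convolution product with respect to concatenation.\<close>

datatype 'g star_word = Star_Word (letters: "('g \<times> bool) list")

instantiation star_word :: (type) monoid_add
begin
definition zero_star_word :: "'a star_word" where "0 = Star_Word []"
definition plus_star_word :: "'a star_word \<Rightarrow> 'a star_word \<Rightarrow> 'a star_word" where
  "v + w = Star_Word (letters v @ letters w)"
instance
  by standard (simp_all add: zero_star_word_def plus_star_word_def)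
end

type_synonym 'g star_poly = "'g star_word \<Rightarrow>\<^sub>0 complex"

definition gen :: "'g \<Rightarrow> 'g star_poly" where
  "gen x = Poly_Mapping.single (Star_Word [(x, False)]) 1"

definition poly_scale :: "complex \<Rightarrow> 'g star_poly \<Rightarrow> 'g star_poly" where
  "poly_scale c f = Poly_Mapping.single 0 c * f"

definition word_adj :: "'g star_word \<Rightarrow> 'g star_word" where
  "word_adj w = Star_Word (rev (map (\<lambda>(x, s). (x, \<not> s)) (letters w)))"

definition poly_star :: "'g star_poly \<Rightarrow> 'g star_poly" where
  "poly_star f =
     (\<Sum>w\<in>Poly_Mapping.keys f. Poly_Mapping.single (word_adj w) (cnj (Poly_Mapping.lookup f w)))"

definition word_eval :: "('g \<Rightarrow> 'a::cstar_algebra) \<Rightarrow> 'g star_word \<Rightarrow> 'a" where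
  "word_eval g w = prod_list (map (\<lambda>(x, s). if s then star (g x) else g x) (letters w))"

definition poly_eval :: "('g \<Rightarrow> 'a::cstar_algebra) \<Rightarrow> 'g star_poly \<Rightarrow> 'a" where
  "poly_eval g f =
     (\<Sum>w\<in>Poly_Mapping.keys f. Poly_Mapping.lookup f w *\<^sub>C word_eval g w)"


section \<open>Universal C*-algebras\<close>

definition cstar_seminorm :: "('g star_poly \<Rightarrow> real) \<Rightarrow> bool" where
  "cstar_seminorm p \<longleftrightarrow>
     (\<forall>x. 0 \<le> p x) \<and> (\<forall>x y. p (x + y) \<le> p x + p y) \<and>
     (\<forall>c x. p (poly_scale c x) = cmod c * p x) \<and>
     (\<forall>x y. p (x * y) \<le> p x * p y) \<and> (\<forall>x. p (poly_star x * x) = (p x)\<^sup>2)"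

text \<open>The universal unital C*-algebra on generators \<open>g\<close> subject to the relations \<open>r = 0\<close>,
  \<open>r \<in> R\<close>, is the completion of the free *-algebra with respect to the largest C*-seminorm
  that vanishes on \<open>R\<close>. Seminorms replace a quantification over all C*-algebras, which cannot be
  expressed inside a formula; the universal property for targets of arbitrary type is
  \<open>universal_cstar_hom_exists\<close> below.\<close>

definition universal_cstar :: "'g star_poly set \<Rightarrow> ('g \<Rightarrow> 'a::cstar_algebra) \<Rightarrow> bool" where
  "universal_cstar R g \<longleftrightarrow>
     (\<forall>r\<in>R. poly_eval g r = 0) \<and>
     closure (range (poly_eval g)) = UNIV \<and>
     (\<forall>p. cstar_seminorm p \<and> (\<forall>r\<in>R. p r = 0) \<longrightarrow> (\<forall>x. p x \<le> norm (poly_eval g x)))"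

definition cuntz_relations :: "'n::finite star_poly set" where
  "cuntz_relations =
     {poly_star (gen i) * gen i - 1 | i. True} \<union> {(\<Sum>j\<in>UNIV. gen j * poly_star (gen j)) - 1}"

definition projection_rels :: "'g star_poly \<Rightarrow> 'g star_poly set" where
  "projection_rels x = {poly_star x - x, x * x - x}"

definition partial_isometry_rel :: "'g star_poly \<Rightarrow> 'g star_poly" where
  "partial_isometry_rel x = x * poly_star x * x - x"

definition magic_unitary_rels :: "('n::finite \<Rightarrow> 'n \<Rightarrow> 'g star_poly) \<Rightarrow> 'g star_poly set" where
  "magic_unitary_rels m =
     (\<Union>i j. projection_rels (m i j)) \<union>
     {(\<Sum>j\<in>UNIV. m i j) - 1 | i. True} \<union> {(\<Sum>i\<in>UNIV. m i j) - 1 | j. True}"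

definition range_poly :: "'n \<Rightarrow> 'n \<Rightarrow> ('n \<times> 'n) star_poly" where
  "range_poly i j = gen (i, j) * poly_star (gen (i, j))"

definition source_poly :: "'n \<Rightarrow> 'n \<Rightarrow> ('n \<times> 'n) star_poly" where
  "source_poly i j = poly_star (gen (i, j)) * gen (i, j)"

text \<open>A pair of words \<open>\<alpha>, \<beta>\<close> of equal length is a list of pairs of letters. The partial isometry
  relations for the \<open>u i j\<close> themselves are those for words of length 1. For the constant vector,
  \<open>p \<cdot> u = u 1\<close> and \<open>q \<cdot> u = u 1\<close> are the row sum relations of the two magic unitaries. The last
  set is the intertwining relation \<open>A p = q A\<close> for the all-ones matrix \<open>A\<close>.\<close>

definition quantum_sym_relations :: "('n::finite \<times> 'n) star_poly set" where
  "quantum_sym_relations =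
     magic_unitary_rels range_poly \<union> magic_unitary_rels source_poly \<union>
     {partial_isometry_rel (prod_list (map gen ab)) | ab. True} \<union>
     {(\<Sum>k\<in>UNIV. range_poly k j) - (\<Sum>k\<in>UNIV. source_poly i k) | i j. True}"

definition cuntz_algebra :: "('n::finite \<Rightarrow> 'a::cstar_algebra) \<Rightarrow> bool" where
  "cuntz_algebra S \<longleftrightarrow> universal_cstar cuntz_relations S"

definition quantum_sym_algebra :: "('n::finite \<Rightarrow> 'n \<Rightarrow> 'a::cstar_algebra) \<Rightarrow> bool" where
  "quantum_sym_algebra u \<longleftrightarrow> universal_cstar quantum_sym_relations (\<lambda>(i, j). u i j)"


section \<open>Representations on \<open>\<ell>\<^sup>2\<close> and the minimal tensor product\<close>

definition ell2 :: "('x \<Rightarrow> complex) set" where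
  "ell2 = {f. (\<lambda>x. (cmod (f x))\<^sup>2) summable_on UNIV}"

definition ell2_norm :: "('x \<Rightarrow> complex) \<Rightarrow> real" where
  "ell2_norm f = sqrt (\<Sum>\<^sub>\<infinity>x. (cmod (f x))\<^sup>2)"

definition ell2_inner :: "('x \<Rightarrow> complex) \<Rightarrow> ('x \<Rightarrow> complex) \<Rightarrow> complex" where
  "ell2_inner f g = (\<Sum>\<^sub>\<infinity>x. cnj (f x) * g x)"

definition ell2_bounded_op :: "(('x \<Rightarrow> complex) \<Rightarrow> ('x \<Rightarrow> complex)) \<Rightarrow> bool" where
  "ell2_bounded_op P \<longleftrightarrow>
     (\<forall>f\<in>ell2. P f \<in> ell2) \<and>
     (\<forall>f\<in>ell2. \<forall>g\<in>ell2. P (\<lambda>x. f x + g x) = (\<lambda>x. P f x + P g x)) \<and>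
     (\<forall>c. \<forall>f\<in>ell2. P (\<lambda>x. c * f x) = (\<lambda>x. c * P f x)) \<and>
     (\<exists>C. \<forall>f\<in>ell2. ell2_norm (P f) \<le> C * ell2_norm f)"

definition ell2_onorm :: "(('x \<Rightarrow> complex) \<Rightarrow> ('x \<Rightarrow> complex)) \<Rightarrow> real" where
  "ell2_onorm P = (SUP f\<in>{f\<in>ell2. ell2_norm f \<le> 1}. ell2_norm (P f))"

text \<open>Operators are compared on \<^const>\<open>ell2\<close> only. Injective *-homomorphisms of C*-algebras are
  isometric, so these are the faithful unital representations.\<close>

definition faithful_rep :: "('a::cstar_algebra \<Rightarrow> ('x \<Rightarrow> complex) \<Rightarrow> ('x \<Rightarrow> complex)) \<Rightarrow> bool" where
  "faithful_rep \<pi> \<longleftrightarrow>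
     (\<forall>a. ell2_bounded_op (\<pi> a)) \<and>
     (\<forall>f\<in>ell2. \<pi> 1 f = f \<and>
        (\<forall>a b. \<pi> (a + b) f = (\<lambda>x. \<pi> a f x + \<pi> b f x)) \<and>
        (\<forall>c a. \<pi> (c *\<^sub>C a) f = (\<lambda>x. c * \<pi> a f x)) \<and>
        (\<forall>a b. \<pi> (a * b) f = \<pi> a (\<pi> b f)) \<and>
        (\<forall>a. \<forall>g\<in>ell2. ell2_inner (\<pi> (star a) f) g = ell2_inner f (\<pi> a g))) \<and>
     (\<forall>a. ell2_onorm (\<pi> a) = norm a)"

text \<open>\<open>op_tensor P Q = (P \<otimes> 1) (1 \<otimes> Q)\<close> on \<open>\<ell>\<^sup>2(X \<times> Y) = \<ell>\<^sup>2(X) \<otimes> \<ell>\<^sup>2(Y)\<close>, each factor acting on slices.\<close>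

definition op_tensor :: "(('x \<Rightarrow> complex) \<Rightarrow> ('x \<Rightarrow> complex)) \<Rightarrow> (('y \<Rightarrow> complex) \<Rightarrow> ('y \<Rightarrow> complex)) \<Rightarrow>
    ('x \<times> 'y \<Rightarrow> complex) \<Rightarrow> ('x \<times> 'y \<Rightarrow> complex)" where
  "op_tensor P Q f = (\<lambda>(x, y). P (\<lambda>x'. Q (\<lambda>y'. f (x', y')) y) x)"

text \<open>\<open>tens\<close> is the canonical bilinear map from \<open>'b \<times> 'a\<close> into the completion \<open>'t\<close> of the algebraic
  tensor product in the spatial norm, which does not depend on the chosen faithful
  representations. Every C*-algebra has a faithful representation on \<open>\<ell>\<^sup>2\<close> of its own underlying set,
  so these index types are no restriction.\<close>

definition minimal_tensor_product ::
    "('b::cstar_algebra \<Rightarrow> 'a::cstar_algebra \<Rightarrow> 't::cstar_algebra) \<Rightarrow> bool" where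
  "minimal_tensor_product tens \<longleftrightarrow>
     (\<forall>b b' a. tens (b + b') a = tens b a + tens b' a) \<and>
     (\<forall>b a a'. tens b (a + a') = tens b a + tens b a') \<and>
     (\<forall>c b a. tens (c *\<^sub>C b) a = c *\<^sub>C tens b a \<and> tens b (c *\<^sub>C a) = c *\<^sub>C tens b a) \<and>
     (\<forall>b b' a a'. tens b a * tens b' a' = tens (b * b') (a * a')) \<and>
     (\<forall>b a. star (tens b a) = tens (star b) (star a)) \<and>
     tens 1 1 = 1 \<and>
     closure {\<Sum>(b, a)\<leftarrow>xs. tens b a | xs. True} = UNIV \<and>
     (\<exists>(\<pi> :: 'b \<Rightarrow> ('b \<Rightarrow> complex) \<Rightarrow> ('b \<Rightarrow> complex)) (\<rho> :: 'a \<Rightarrow> ('a \<Rightarrow> complex) \<Rightarrow> ('a \<Rightarrow> complex)).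
        faithful_rep \<pi> \<and> faithful_rep \<rho> \<and>
        (\<forall>xs. norm (\<Sum>(b, a)\<leftarrow>xs. tens b a) =
              ell2_onorm (\<lambda>f z. \<Sum>(b, a)\<leftarrow>xs. op_tensor (\<pi> b) (\<rho> a) f z)))"


section \<open>Lemmas\<close>

lemma scaleC_zero_left [simp]: "0 *\<^sub>C (x::'a::cstar_algebra) = 0"
  using scaleC_of_real[of 0 x] by simp

lemma scaleC_one [simp]: "1 *\<^sub>C (x::'a::cstar_algebra) = x"
  using scaleC_of_real[of 1 x] by simp

lemma scaleC_zero_right [simp]: "c *\<^sub>C (0::'a::cstar_algebra) = 0"
  using norm_scaleC[of c "0::'a"] by simp

lemma scaleC_minus_right: "c *\<^sub>C (- x) = - (c *\<^sub>C (x::'a::cstar_algebra))"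
  using scaleC_add_right[of c x "- x"] by (simp add: eq_neg_iff_add_eq_0 add.commute)

lemma scaleC_diff_right: "c *\<^sub>C (x - y) = c *\<^sub>C x - c *\<^sub>C (y::'a::cstar_algebra)"
  using scaleC_add_right[of c x "- y"] by (simp add: scaleC_minus_right)

lemma scaleC_sum_right: "c *\<^sub>C (\<Sum>i\<in>I. f i) = (\<Sum>i\<in>I. c *\<^sub>C (f i::'a::cstar_algebra))"
  by (induction I rule: infinite_finite_induct) (simp_all add: scaleC_add_right)

lemma star_zero [simp]: "star (0::'a::cstar_algebra) = 0"
  using star_add[of "0::'a" 0] by simp

lemma star_one [simp]: "star (1::'a::cstar_algebra) = 1"
  using star_mult[of "star (1::'a)" 1] by (simp add: star_star)

lemma star_minus: "star (- x) = - star (x::'a::cstar_algebra)"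
  using star_add[of x "- x"] by (simp add: eq_neg_iff_add_eq_0 add.commute)

lemma star_diff: "star (x - y) = star x - star (y::'a::cstar_algebra)"
  using star_add[of x "- y"] by (simp add: star_minus)

lemma star_sum: "star (\<Sum>i\<in>I. f i) = (\<Sum>i\<in>I. star (f i::'a::cstar_algebra))"
  by (induction I rule: infinite_finite_induct) (simp_all add: star_add)

lemma norm_star: "norm (star x) = norm (x::'a::cstar_algebra)"
proof -
  have *: "norm y \<le> norm (star y)" for y :: 'a
  proof (cases "norm y = 0")
    case False
    have "norm y * norm y \<le> norm (star y) * norm y"
      using norm_mult_ineq[of "star y" y] by (simp add: norm_star_mult_self power2_eq_square)
    then show ?thesis using False by simp
  qed auto
  show ?thesis using *[of x] *[of "star x"] by (simp add: star_star)
qed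

lemma tendsto_star:
  "(f \<longlongrightarrow> (x::'a::cstar_algebra)) F \<Longrightarrow> ((\<lambda>z. star (f z)) \<longlongrightarrow> star x) F"
  unfolding tendsto_iff dist_norm by (simp flip: star_diff add: norm_star)

lemma tendsto_scaleC:
  assumes "(f \<longlongrightarrow> (x::'a::cstar_algebra)) F"
  shows "((\<lambda>z. c *\<^sub>C f z) \<longlongrightarrow> c *\<^sub>C x) F"
proof -
  have "((\<lambda>z. norm (f z - x)) \<longlongrightarrow> 0) F"
    using assms by (simp add: LIM_zero_iff tendsto_norm_zero_iff)
  then have "((\<lambda>z. cmod c * norm (f z - x)) \<longlongrightarrow> 0) F"
    using tendsto_mult_right_zero by blast
  then have "((\<lambda>z. c *\<^sub>C f z - c *\<^sub>C x) \<longlongrightarrow> 0) F"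
    by (simp flip: scaleC_diff_right norm_scaleC add: tendsto_norm_zero_iff)
  then show ?thesis by (simp add: LIM_zero_iff)
qed

subsection \<open>Evaluation is a *-homomorphism\<close>

lemma star_poly_induct [case_names zero add]:
  fixes f :: "'g star_poly"
  assumes "P 0" and "\<And>f w c. P f \<Longrightarrow> P (f + Poly_Mapping.single w c)"
  shows "P f"
proof -
  have *: "f = (\<Sum>w\<in>Poly_Mapping.keys f. Poly_Mapping.single w (Poly_Mapping.lookup f w))"
    by (rule poly_mapping_eqI)
       (auto simp: lookup_sum lookup_single when_def in_keys_iff sum.delta)
  have "P (\<Sum>w\<in>A. Poly_Mapping.single w (Poly_Mapping.lookup f w))" if "finite A" for A
    using that
  proof induction
    case (insert w A)
    then show ?case by (metis assms(2) add.commute sum.insert)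
  qed (simp add: assms)
  from this[of "Poly_Mapping.keys f"] * show ?thesis by simp
qed

lemma poly_eval_superset:
  "finite A \<Longrightarrow> Poly_Mapping.keys f \<subseteq> A \<Longrightarrow>
     poly_eval g f = (\<Sum>w\<in>A. Poly_Mapping.lookup f w *\<^sub>C word_eval g w)"
  unfolding poly_eval_def by (rule sum.mono_neutral_left) (auto simp: in_keys_iff)

lemma poly_eval_zero [simp]: "poly_eval g 0 = 0"
  by (simp add: poly_eval_def)

lemma poly_eval_add: "poly_eval g (f + h) = poly_eval g f + poly_eval g h"
proof -
  let ?A = "Poly_Mapping.keys f \<union> Poly_Mapping.keys h"
  have "poly_eval g (f + h) = (\<Sum>w\<in>?A. Poly_Mapping.lookup (f + h) w *\<^sub>C word_eval g w)"
    using keys_add[of f h] by (intro poly_eval_superset) auto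
  then show ?thesis
    by (simp add: poly_eval_superset[of ?A f] poly_eval_superset[of ?A h] lookup_add
        scaleC_add_left sum.distrib)
qed

lemma poly_eval_single: "poly_eval g (Poly_Mapping.single w c) = c *\<^sub>C word_eval g w"
  by (simp add: poly_eval_def)

lemma word_eval_plus: "word_eval g (v + w) = word_eval g v * word_eval g w"
  by (simp add: word_eval_def plus_star_word_def)

lemma word_eval_zero [simp]: "word_eval g 0 = 1"
  by (simp add: word_eval_def zero_star_word_def)

lemma poly_eval_mult_single:
  "poly_eval g (f * Poly_Mapping.single w c) = poly_eval g f * (c *\<^sub>C word_eval g w)"
  by (induction f rule: star_poly_induct)
     (simp_all add: distrib_right poly_eval_add mult_single poly_eval_single word_eval_plus
        mult_scaleC_left mult_scaleC_right scaleC_scaleC scaleC_add_right mult.commute[of c])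

lemma poly_eval_mult: "poly_eval g (f * h) = poly_eval g f * poly_eval g h"
  by (induction h rule: star_poly_induct)
     (simp_all add: distrib_left poly_eval_add poly_eval_mult_single poly_eval_single)

lemma poly_eval_one [simp]: "poly_eval g 1 = 1"
  by (metis poly_eval_single scaleC_one single_one word_eval_zero)

lemma poly_eval_scale: "poly_eval g (poly_scale c f) = c *\<^sub>C poly_eval g f"
  by (simp add: poly_scale_def poly_eval_mult poly_eval_single mult_scaleC_left)

lemma poly_eval_sum: "poly_eval g (\<Sum>i\<in>I. f i) = (\<Sum>i\<in>I. poly_eval g (f i))"
  by (induction I rule: infinite_finite_induct) (simp_all add: poly_eval_add)

lemma poly_eval_diff: "poly_eval g (f - h) = poly_eval g f - poly_eval g h"
  using poly_eval_add[of g "f - h" h] by (simp add: algebra_simps)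

lemma poly_eval_gen [simp]: "poly_eval g (gen x) = g x"
  by (simp add: gen_def poly_eval_single word_eval_def)

lemma word_eval_adj: "word_eval g (word_adj w) = star (word_eval g w)"
proof -
  have "prod_list (map (\<lambda>(x, s). if s then star (g x) else g x) (rev (map (\<lambda>(x, s). (x, \<not> s)) ls)))
      = star (prod_list (map (\<lambda>(x, s). if s then star (g x) else g x) ls))" for ls
    by (induction ls) (auto simp: star_mult star_star)
  then show ?thesis by (simp add: word_eval_def word_adj_def)
qed

lemma poly_eval_star: "poly_eval g (poly_star f) = star (poly_eval g f)"
  unfolding poly_star_def poly_eval_sum poly_eval_single word_eval_adj
  by (simp add: poly_eval_def star_sum star_scaleC)

lemma cstar_seminorm_eval: "cstar_seminorm (\<lambda>x. norm (poly_eval g x))"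
  by (simp add: cstar_seminorm_def poly_eval_add poly_eval_mult poly_eval_scale poly_eval_star
      norm_triangle_ineq norm_mult_ineq norm_scaleC norm_star_mult_self)

subsection \<open>The universal property\<close>

lemma universal_cstar_norm_le:
  assumes "universal_cstar R g" "\<forall>r\<in>R. poly_eval h r = 0"
  shows "norm (poly_eval h x) \<le> norm (poly_eval g x)"
proof -
  have "cstar_seminorm (\<lambda>x. norm (poly_eval h x)) \<and> (\<forall>r\<in>R. norm (poly_eval h r) = 0)"
    using assms(2) by (simp add: cstar_seminorm_eval)
  with assms(1) show ?thesis unfolding universal_cstar_def by blast
qed

theorem universal_cstar_hom_exists:
  fixes g :: "'g \<Rightarrow> 'a::cstar_algebra" and h :: "'g \<Rightarrow> 'd::cstar_algebra"
  assumes univ: "universal_cstar R g" and rel: "\<forall>r\<in>R. poly_eval h r = 0"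
  shows "\<exists>f. unital_star_hom f \<and> (\<forall>x. f (g x) = h x)"
proof -
  note le = universal_cstar_norm_le[OF univ rel]
  define X where "X = range (poly_eval g)"
  define k where "k = (\<lambda>a. poly_eval h (SOME x. poly_eval g x = a))"
  have k: "k (poly_eval g x) = poly_eval h x" for x
  proof -
    have "poly_eval g (SOME y. poly_eval g y = poly_eval g x) = poly_eval g x"
      by (rule someI) simp
    with le[of "(SOME y. poly_eval g y = poly_eval g x) - x"] show ?thesis
      by (simp add: poly_eval_diff k_def)
  qed
  have lip: "dist (k a) (k b) \<le> dist a b" if ab: "a \<in> X" "b \<in> X" for a b
  proof -
    obtain x y where "a = poly_eval g x" "b = poly_eval g y" using ab by (auto simp: X_def)
    with le[of "x - y"] show ?thesis by (simp add: k dist_norm poly_eval_diff)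
  qed
  have "uniformly_continuous_on X k"
    unfolding uniformly_continuous_on_def using lip le_less_trans by metis
  then obtain f where f: "uniformly_continuous_on (closure X) f" "\<And>a. a \<in> X \<Longrightarrow> k a = f a"
    using uniformly_continuous_on_extension_on_closure by metis
  have cX: "closure X = UNIV" using univ by (simp add: universal_cstar_def X_def)
  have cont: "isCont f a" for a
    using f(1) cX uniformly_continuous_imp_continuous continuous_on_eq_continuous_at open_UNIV by force
  have fe: "f (poly_eval g x) = poly_eval h x" for x using f(2) k by (metis X_def rangeI)
  have lim: "\<exists>s. (\<lambda>n. poly_eval g (s n)) \<longlonglongrightarrow> a \<and> (\<lambda>n. poly_eval h (s n)) \<longlonglongrightarrow> f a" for a
  proof -
    obtain t where t: "\<forall>n. t n \<in> X" "t \<longlonglongrightarrow> a" using cX closure_sequential by (metis UNIV_I)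
    then have "\<forall>n. \<exists>x. t n = poly_eval g x" by (auto simp: X_def)
    then obtain s where s: "t = (\<lambda>n. poly_eval g (s n))" by metis
    have "(\<lambda>n. f (t n)) \<longlonglongrightarrow> f a" using cont t(2) isCont_tendsto_compose by blast
    with t(2) show ?thesis unfolding s fe by blast
  qed
  have pass: "f a = b" if "(\<lambda>n. poly_eval g (s n)) \<longlonglongrightarrow> a" "(\<lambda>n. poly_eval h (s n)) \<longlonglongrightarrow> b" for s a b
    using that isCont_tendsto_compose[OF cont that(1)] LIMSEQ_unique by (simp add: fe)
  have "unital_star_hom f"
    unfolding unital_star_hom_def
  proof (intro conjI allI)
    fix a b :: 'a and c
    obtain s where s: "(\<lambda>n. poly_eval g (s n)) \<longlonglongrightarrow> a" "(\<lambda>n. poly_eval h (s n)) \<longlonglongrightarrow> f a" using lim by blast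
    obtain t where t: "(\<lambda>n. poly_eval g (t n)) \<longlonglongrightarrow> b" "(\<lambda>n. poly_eval h (t n)) \<longlonglongrightarrow> f b" using lim by blast
    show "f (a + b) = f a + f b"
      using s t by (intro pass[of "\<lambda>n. s n + t n"]) (simp_all add: poly_eval_add tendsto_add)
    show "f (a * b) = f a * f b"
      using s t by (intro pass[of "\<lambda>n. s n * t n"]) (simp_all add: poly_eval_mult tendsto_mult)
    show "f (c *\<^sub>C a) = c *\<^sub>C f a"
      using s by (intro pass[of "\<lambda>n. poly_scale c (s n)"]) (simp_all add: poly_eval_scale tendsto_scaleC)
    show "f (star a) = star (f a)"
      using s by (intro pass[of "\<lambda>n. poly_star (s n)"]) (simp_all add: poly_eval_star tendsto_star)
  qed (metis fe poly_eval_one)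
  moreover have "f (g x) = h x" for x by (metis fe poly_eval_gen)
  ultimately show ?thesis by blast
qed

end

theory Submission
  imports Defs
begin

text \<open>Slicing the second leg of \<open>\<phi> a = 1 \<otimes> a\<close> with a vector functional \<open>\<omega> = \<langle>\<eta>, \<rho>(\<cdot>) \<xi>\<rangle>\<close> is contractive
  by the very definition of the spatial norm, so it suffices to find, for every \<open>n\<close>, a contractive
  unital linear map \<open>\<Phi>\<close> on the quantum symmetry algebra with \<open>\<Phi>(u\<^bsub>\<alpha>\<gamma>\<^esub> u\<^bsub>\<beta>\<delta>\<^esub>\<^sup>*) = \<tau>(\<alpha>) 1\<close> if \<open>\<alpha> = \<beta>\<close> and
  \<open>\<gamma> = \<delta>\<close>, and \<open>0\<close> otherwise, for all words of length at most \<open>n\<close>: then \<open>(\<Phi> \<otimes> \<omega>) \<phi>(x) = \<tau>(x) \<omega>(1) 1\<close>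
  for every \<open>x\<close> in the span of the \<open>S\<^sub>\<alpha> S\<^sub>\<beta>\<^sup>*\<close>, whence \<open>\<parallel>\<tau>(x) 1 - a\<parallel> \<le> \<parallel>x - a\<parallel>\<close>.
  Such a \<open>\<Phi>\<close> comes from matrix models \<open>u\<^sub>i\<^sub>j = D\<^sub>i\<^sub>j U\<close>, where \<open>U\<close> is a cyclic shift on more than \<open>n\<close> points
  and \<open>D\<^sub>i\<^sub>j\<close> is diagonal with entries the \<open>(i, j)\<close> coefficients of signed permutation matrices chosen
  independently at each point. The shift kills words of different lengths, and averaging over all
  choices kills the remaining unwanted coefficients. The models live in the Cuntz algebra itself,
  which contains matrix units of arbitrarily large size.\<close>

section \<open>Unital *-homomorphisms are contractive\<close>

lemma norm_le_one_of_square_sum: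
  fixes y v :: "'a::cstar_algebra"
  assumes y: "star y = y" and v: "star v = v" and comm: "v * y = y * v"
    and sum: "y * y + v * v = 1"
  shows "norm y \<le> 1"
proof -
  \<comment> \<open>\<open>y\<close> is the real part of the unitary \<open>y + i v\<close>.\<close>
  define g where "g = y + \<i> *\<^sub>C v"
  have g: "star g = y - \<i> *\<^sub>C v"
    using scaleC_add_left[of "-\<i>" \<i> v] by (simp add: g_def star_add star_scaleC y v eq_neg_iff_add_eq_0)
  have "star g * g = y * y + v * v"
    unfolding g using scaleC_of_real[of "-1" "v * v"]
    by (simp add: g_def algebra_simps mult_scaleC_left mult_scaleC_right scaleC_scaleC
        scaleC_diff_right comm)
  then have ng: "norm g = 1"
    using norm_star_mult_self[of g] norm_ge_zero[of g] by (simp add: sum power2_eq_1_iff)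
  have "2 *\<^sub>R y = g + star g" unfolding g by (simp add: g_def scaleR_2)
  then have "2 * norm y = norm (g + star g)" by (metis abs_numeral norm_scaleR)
  also have "\<dots> \<le> 2" using norm_triangle_ineq[of g "star g"] ng by (simp add: norm_star)
  finally show ?thesis by simp
qed

lemma self_adjoint_sqrt_exists:
  fixes z :: "'a::cstar_algebra"
  assumes z: "star z = z" and nz: "norm z < 1"
  shows "\<exists>w. star w = w \<and> w * z = z * w \<and> z * z + w * w = 1"
proof -
  \<comment> \<open>\<open>w = 1 - s\<close>, where \<open>s\<close> is the fixed point of \<open>s \<mapsto> (z\<^sup>2 + s\<^sup>2) / 2\<close>.\<close>
  define c where "c = norm (z * z)"
  have c: "0 \<le> c" "c < 1"
  proof -
    have "c \<le> norm z * norm z" by (simp add: c_def norm_mult_ineq)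
    also have "\<dots> < 1" using nz by (metis norm_ge_zero mult_strict_mono' mult_1)
    finally show "c < 1" .
  qed (simp add: c_def)
  \<comment> \<open>Self-adjointness and commutation with z are closed conditions preserved by f, so
    building them into X transfers them to the fixed point. The number c serves both as the radius
    of the ball and as the contraction constant.\<close>
  define X where "X = {s::'a. norm s \<le> c} \<inter> ({s. star s = s} \<inter> {s. s * z = z * s})"
  define f where "f = (\<lambda>s::'a. (1/2) *\<^sub>R (z * z + s * s))"
  have "continuous_on UNIV (star :: 'a \<Rightarrow> 'a)"
    unfolding continuous_on_def by (intro ballI tendsto_star tendsto_ident_at)
  then have "closed X" unfolding X_def
    by (intro closed_Int closed_Collect_le closed_Collect_eq continuous_intros)
  then have "complete X" using complete_eq_closed by blast
  moreover have "X \<noteq> {}" proof -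
    have "0 \<in> X" using c by (simp add: X_def)
    then show ?thesis by blast
  qed
  moreover have "f ` X \<subseteq> X"
  proof clarify
    fix s assume "s \<in> X"
    then have s: "norm s \<le> c" "star s = s" "s * z = z * s" by (auto simp: X_def)
    have "norm (z * z + s * s) \<le> c + norm s * norm s"
      using norm_triangle_ineq[of "z * z" "s * s"] norm_mult_ineq[of s s] by (simp add: c_def)
    also have "norm s * norm s \<le> c * 1" using s c by (intro mult_mono) auto
    finally have "norm (f s) \<le> c" by (simp add: f_def)
    moreover have "star (f s) = f s"
      using star_scaleC[of "complex_of_real (1/2)" "z * z + s * s"]
      by (simp only: f_def scaleC_of_real complex_cnj_complex_of_real)
         (simp add: star_add star_mult z s)
    moreover have "s * s * z = z * (s * s)" 
      by (simp add: mult.assoc s(3)) (simp flip: mult.assoc add: s(3))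
    then have "f s * z = z * f s" by (simp add: f_def distrib_left distrib_right mult.assoc)
    ultimately show "f s \<in> X" by (simp add: X_def)
  qed
  moreover have "\<And>x y. x \<in> X \<Longrightarrow> y \<in> X \<Longrightarrow> dist (f x) (f y) \<le> c * dist x y"
  proof -
    fix x y assume "x \<in> X" "y \<in> X"
    then have n: "norm x \<le> c" "norm y \<le> c" by (auto simp: X_def)
    have "x * x - y * y = x * (x - y) + (x - y) * y" by (simp add: algebra_simps)
    then have "norm (x * x - y * y) \<le> norm x * norm (x - y) + norm (x - y) * norm y"
      by (metis add_mono norm_mult_ineq norm_triangle_le)
    also have "\<dots> \<le> c * norm (x - y) + norm (x - y) * c"
      using n c by (intro add_mono mult_mono) auto
    finally have "norm (x * x - y * y) \<le> 2 * c * norm (x - y)" by simp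
    moreover have "f x - f y = (1/2) *\<^sub>R (x * x - y * y)" by (simp add: f_def algebra_simps)
    ultimately show "dist (f x) (f y) \<le> c * dist x y" by (simp add: dist_norm)
  qed
  ultimately have "\<exists>!s. s \<in> X \<and> f s = s" using c by (intro Banach_fix) auto
  then obtain s where "s \<in> X" "f s = s" by blast
  then have s: "star s = s" "s * z = z * s" and "s = (1/2) *\<^sub>R (z * z + s * s)"
    by (auto simp: X_def f_def)
  then have "2 *\<^sub>R s = 2 *\<^sub>R (1/2) *\<^sub>R (z * z + s * s)" by metis
  then have s3: "2 *\<^sub>R s = z * z + s * s" by simp
  show ?thesis
  proof (intro exI[of _ "1 - s"] conjI)
    show "z * z + (1 - s) * (1 - s) = 1" using s3 by (simp add: algebra_simps scaleR_2)
  qed (simp_all add: star_diff s algebra_simps)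
qed

text \<open>A relation \<open>z * z + w * w = 1\<close> between commuting self-adjoint elements is
  carried along by f and bounds \<open>norm (f z)\<close> by 1 in the target. Rescaling treats all
  self-adjoint elements, and the C*-identity reduces the general case to
  \<open>star x * x\<close>.\<close>

lemma unital_star_hom_contractive:
  fixes f :: "'a::cstar_algebra \<Rightarrow> 'b::cstar_algebra"
  assumes "unital_star_hom f"
  shows "norm (f x) \<le> norm x"
proof -
  have add: "f (x + y) = f x + f y" and mult: "f (x * y) = f x * f y"
    and scale: "f (c *\<^sub>C x) = c *\<^sub>C f x" and star: "f (star x) = star (f x)" and one: "f 1 = 1"
    for x y c using assms by (auto simp: unital_star_hom_def)
  have unit: "norm (f z) \<le> 1" if z: "star z = z" and nz: "norm z < 1" for z
  proof -
    obtain w where w: "star w = w" "w * z = z * w" "z * z + w * w = 1"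
      using self_adjoint_sqrt_exists[OF z nz] by blast
    show ?thesis
    proof (rule norm_le_one_of_square_sum)
      show "star (f z) = f z" using star[of z] z by simp
      show "star (f w) = f w" using star[of w] w by simp
      show "f w * f z = f z * f w" using w(2) by (simp flip: mult)
      show "f z * f z + f w * f w = 1" using w(3) by (simp flip: mult add one)
    qed
  qed
  have sa: "norm (f z) \<le> norm z" if z: "star z = z" for z
  \<comment> \<open>Dividing by some r above the norm, rather than by the norm itself, gives the
    strict inequality that \<open>unit\<close> asks for and covers z = 0.\<close>
  proof (rule dense_ge)
    fix r assume "norm z < r"
    then have r: "0 < r" by (smt (verit) norm_ge_zero)
    have "star (complex_of_real (1/r) *\<^sub>C z) = complex_of_real (1/r) *\<^sub>C z"
      by (simp only: star_scaleC z complex_cnj_complex_of_real)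
    moreover have "norm (complex_of_real (1/r) *\<^sub>C z) < 1"
      using r \<open>norm z < r\<close> by (simp add: norm_scaleC norm_divide)
    ultimately have "norm (f (complex_of_real (1/r) *\<^sub>C z)) \<le> 1" by (rule unit)
    then show "norm (f z) \<le> r" using r by (simp add: scale norm_scaleC norm_divide field_simps)
  qed
  have "(norm (f x))\<^sup>2 = norm (f (star x * x))" by (simp add: mult star norm_star_mult_self)
  also have "\<dots> \<le> norm (star x * x)" by (rule sa) (simp add: star_mult star_star)
  finally show ?thesis by (simp add: norm_star_mult_self)
qed

section \<open>Slice maps on the minimal tensor product\<close>

lemma ell2_norm_nonneg: "0 \<le> ell2_norm f"
  by (simp add: ell2_norm_def infsum_nonneg)

lemma ell2_norm_power2: "(ell2_norm f)\<^sup>2 = (\<Sum>\<^sub>\<infinity>x. (cmod (f x))\<^sup>2)"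
  by (simp add: ell2_norm_def infsum_nonneg)

lemma ell2_summable: "f \<in> ell2 \<Longrightarrow> (\<lambda>x. (cmod (f x))\<^sup>2) summable_on UNIV"
  by (simp add: ell2_def)

lemma ell2_abs_summable_mult:
  assumes "f \<in> ell2" "g \<in> ell2"
  shows "(\<lambda>x. norm (cnj (f x) * g x)) summable_on UNIV"
  by (rule Infinite_Sum.abs_summable_product)
     (use assms in \<open>simp_all add: ell2_def norm_mult power2_eq_square\<close>)

lemma ell2_Cauchy_Schwarz:
  assumes f: "f \<in> ell2" and g: "g \<in> ell2"
  shows "cmod (ell2_inner f g) \<le> ell2_norm f * ell2_norm g"
proof -
  have "cmod (ell2_inner f g) \<le> (\<Sum>\<^sub>\<infinity>x. norm (cnj (f x) * g x))"
    unfolding ell2_inner_def by (intro norm_infsum_bound ell2_abs_summable_mult f g)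
  also have "\<dots> \<le> ell2_norm f * ell2_norm g"
  proof (rule infsum_le_finite_sums[OF ell2_abs_summable_mult[OF f g]])
    fix F :: "'a set" assume F: "finite F"
    have L2: "L2_set (\<lambda>x. cmod (h x)) F \<le> ell2_norm h" if "h \<in> ell2" for h
      unfolding L2_set_def ell2_norm_def
      by (intro real_sqrt_le_mono finite_sum_le_infsum ell2_summable that F) auto
    have "(\<Sum>x\<in>F. norm (cnj (f x) * g x)) \<le> L2_set (\<lambda>x. cmod (f x)) F * L2_set (\<lambda>x. cmod (g x)) F"
      using L2_set_mult_ineq[of "\<lambda>x. cmod (f x)" "\<lambda>x. cmod (g x)" F] by (simp add: norm_mult)
    also have "\<dots> \<le> ell2_norm f * ell2_norm g"
      by (intro mult_mono L2 f g ell2_norm_nonneg L2_set_nonneg)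
    finally show "(\<Sum>x\<in>F. norm (cnj (f x) * g x)) \<le> ell2_norm f * ell2_norm g" .
  qed
  finally show ?thesis .
qed

lemma ell2_inner_self:
  assumes "f \<in> ell2"
  shows "ell2_inner f f = complex_of_real ((ell2_norm f)\<^sup>2)"
proof -
  have *: "cnj z * z = complex_of_real ((cmod z)\<^sup>2)" for z
    using complex_norm_square[of z] by (simp add: mult.commute)
  have "((\<lambda>x. complex_of_real ((cmod (f x))\<^sup>2)) has_sum complex_of_real ((ell2_norm f)\<^sup>2)) UNIV"
    unfolding has_sum_of_real_iff ell2_norm_power2 by (intro has_sum_infsum ell2_summable assms)
  then show ?thesis unfolding ell2_inner_def * by (rule infsumI)
qed

lemma ell2_inner_add:
  assumes "f \<in> ell2" "g \<in> ell2" "h \<in> ell2"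
  shows "ell2_inner f (\<lambda>x. g x + h x) = ell2_inner f g + ell2_inner f h"
  unfolding ell2_inner_def distrib_left
  by (rule infsum_add)
     (rule Infinite_Sum.abs_summable_summable, rule ell2_abs_summable_mult, fact, fact)+

lemma ell2_inner_scale: "ell2_inner f (\<lambda>x. c * g x) = c * ell2_inner f g"
  unfolding ell2_inner_def by (simp add: mult.left_commute[of _ c] infsum_cmult_right')

lemma ell2_zero: "(\<lambda>x. 0) \<in> ell2"
  by (simp add: ell2_def)

lemma ell2_scale:
  assumes "f \<in> ell2"
  shows "(\<lambda>x. c * f x) \<in> ell2" and "ell2_norm (\<lambda>x. c * f x) = cmod c * ell2_norm f"
  using assms
  by (simp_all add: ell2_def ell2_norm_def norm_mult power_mult_distrib summable_on_cmult_right
      infsum_cmult_right' real_sqrt_mult)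

text \<open>The factor 2 comes from 2 s t \<le> s^2 + t^2. So crude a bound is enough to show that
  finite sums of operators are bounded.\<close>

lemma ell2_add:
  assumes f: "f \<in> ell2" and g: "g \<in> ell2"
  shows "(\<lambda>x. f x + g x) \<in> ell2"
    and "(ell2_norm (\<lambda>x. f x + g x))\<^sup>2 \<le> 2 * (ell2_norm f)\<^sup>2 + 2 * (ell2_norm g)\<^sup>2"
proof -
  have le: "(cmod (f x + g x))\<^sup>2 \<le> 2 * (cmod (f x))\<^sup>2 + 2 * (cmod (g x))\<^sup>2" for x
  proof -
    have "(cmod (f x + g x))\<^sup>2 \<le> (cmod (f x) + cmod (g x))\<^sup>2"
      by (intro power_mono norm_triangle_ineq) auto
    also have "\<dots> \<le> 2 * (cmod (f x))\<^sup>2 + 2 * (cmod (g x))\<^sup>2"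
      using sum_squares_bound[of "cmod (f x)" "cmod (g x)"] by (simp add: power2_sum)
    finally show ?thesis .
  qed
  note s = summable_on_cmult_right[OF ell2_summable[OF f], of 2]
    summable_on_cmult_right[OF ell2_summable[OF g], of 2]
  note s12 = summable_on_add[OF s]
  show mem: "(\<lambda>x. f x + g x) \<in> ell2"
    unfolding ell2_def mem_Collect_eq by (rule summable_on_comparison_test[OF s12 le]) auto
  have "(ell2_norm (\<lambda>x. f x + g x))\<^sup>2 \<le> (\<Sum>\<^sub>\<infinity>x. 2 * (cmod (f x))\<^sup>2 + 2 * (cmod (g x))\<^sup>2)"
    unfolding ell2_norm_power2 by (rule infsum_mono[OF ell2_summable[OF mem] s12 le])
  also have "\<dots> = 2 * (ell2_norm f)\<^sup>2 + 2 * (ell2_norm g)\<^sup>2"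
    by (simp add: infsum_add[OF s] infsum_cmult_right' ell2_norm_power2)
  finally show "(ell2_norm (\<lambda>x. f x + g x))\<^sup>2 \<le> 2 * (ell2_norm f)\<^sup>2 + 2 * (ell2_norm g)\<^sup>2" .
qed

subsection \<open>Fubini for \<open>\<ell>\<^sup>2\<close>\<close>

lemma ell2_fst_slice:
  assumes "F \<in> ell2"
  shows "(\<lambda>y. F (x, y)) \<in> ell2"
proof -
  have "(\<lambda>(x, y). (cmod (F (x, y)))\<^sup>2) = (\<lambda>z. (cmod (F z))\<^sup>2)" by auto
  then show ?thesis
    using summable_on_SigmaD1[of "\<lambda>x y. (cmod (F (x, y)))\<^sup>2" UNIV "\<lambda>_. UNIV" x] assms
    by (simp add: ell2_def)
qed

lemma ell2_swap:
  shows "(\<lambda>(y, x). F (x, y)) \<in> ell2 \<longleftrightarrow> F \<in> ell2"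
    and "ell2_norm (\<lambda>(y, x). F (x, y)) = ell2_norm F"
proof -
  have bij: "bij_betw prod.swap UNIV UNIV" by simp
  have *: "(\<lambda>z. (cmod (case z of (y, x) \<Rightarrow> F (x, y)))\<^sup>2) = (\<lambda>z. (cmod (F (prod.swap z)))\<^sup>2)"
    by (auto simp: fun_eq_iff)
  show "(\<lambda>(y, x). F (x, y)) \<in> ell2 \<longleftrightarrow> F \<in> ell2"
    unfolding ell2_def mem_Collect_eq *
    by (rule summable_on_reindex_bij_betw[OF bij, of "\<lambda>z. (cmod (F z))\<^sup>2"])
  show "ell2_norm (\<lambda>(y, x). F (x, y)) = ell2_norm F"
    unfolding ell2_norm_def *
    by (simp add: infsum_reindex_bij_betw[OF bij, of "\<lambda>z. (cmod (F z))\<^sup>2"])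
qed

lemma ell2_Fubini:
  assumes "F \<in> ell2"
  shows "(\<lambda>x. (ell2_norm (\<lambda>y. F (x, y)))\<^sup>2) summable_on UNIV"
    and "(\<Sum>\<^sub>\<infinity>x. (ell2_norm (\<lambda>y. F (x, y)))\<^sup>2) = (ell2_norm F)\<^sup>2"
proof -
  have s: "(\<lambda>z. (cmod (F z))\<^sup>2) summable_on (UNIV \<times> UNIV)" using assms by (simp add: ell2_def)
  have "(\<lambda>(x, y). (cmod (F (x, y)))\<^sup>2) = (\<lambda>z. (cmod (F z))\<^sup>2)" by auto
  then show "(\<lambda>x. (ell2_norm (\<lambda>y. F (x, y)))\<^sup>2) summable_on UNIV"
    unfolding ell2_norm_power2 using s
    by (intro summable_on_Sigma_banach[of "\<lambda>x y. (cmod (F (x, y)))\<^sup>2" UNIV "\<lambda>_. UNIV"]) simp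
  show "(\<Sum>\<^sub>\<infinity>x. (ell2_norm (\<lambda>y. F (x, y)))\<^sup>2) = (ell2_norm F)\<^sup>2"
    unfolding ell2_norm_power2 using infsum_Sigma_banach[OF s] by simp
qed

lemma ell2_prodI:
  assumes "\<And>x. (\<lambda>y. F (x, y)) \<in> ell2"
    and "(\<lambda>x. (ell2_norm (\<lambda>y. F (x, y)))\<^sup>2) summable_on UNIV"
  shows "F \<in> ell2"
proof -
  have "(\<lambda>z. (cmod (F z))\<^sup>2) summable_on (SIGMA x:UNIV. UNIV)"
    by (rule summable_on_SigmaI[where g = "\<lambda>x. (ell2_norm (\<lambda>y. F (x, y)))\<^sup>2"])
       (use assms in \<open>auto simp: ell2_norm_power2 ell2_def intro: has_sum_infsum\<close>)
  then show ?thesis by (simp add: ell2_def)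
qed

text \<open>The squared estimates on the slices are summed over x by \<open>ell2_Fubini\<close>.
  Typically G arises from F by applying one operator of bound C to every slice.\<close>

lemma ell2_prod_bound:
  assumes F: "F \<in> ell2" and G: "\<And>x. (\<lambda>y. G (x, y)) \<in> ell2"
    and le: "\<And>x. ell2_norm (\<lambda>y. G (x, y)) \<le> C * ell2_norm (\<lambda>y. F (x, y))"
  shows "G \<in> ell2" and "(ell2_norm G)\<^sup>2 \<le> C\<^sup>2 * (ell2_norm F)\<^sup>2"
proof -
  have le2: "(ell2_norm (\<lambda>y. G (x, y)))\<^sup>2 \<le> C\<^sup>2 * (ell2_norm (\<lambda>y. F (x, y)))\<^sup>2" for x
    using power_mono[OF le[of x], of 2] by (simp add: power_mult_distrib ell2_norm_nonneg)
  note s = summable_on_cmult_right[OF ell2_Fubini(1)[OF F], of "C\<^sup>2"]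
  show mem: "G \<in> ell2"
    by (rule ell2_prodI[OF G summable_on_comparison_test[OF s le2]]) auto
  have "(ell2_norm G)\<^sup>2 \<le> (\<Sum>\<^sub>\<infinity>x. C\<^sup>2 * (ell2_norm (\<lambda>y. F (x, y)))\<^sup>2)"
    unfolding ell2_Fubini(2)[OF mem, symmetric]
    by (rule infsum_mono[OF ell2_Fubini(1)[OF mem] s le2])
  also have "\<dots> = C\<^sup>2 * (ell2_norm F)\<^sup>2"
    by (simp only: infsum_cmult_right' ell2_Fubini(2)[OF F])
  finally show "(ell2_norm G)\<^sup>2 \<le> C\<^sup>2 * (ell2_norm F)\<^sup>2" .
qed

subsection \<open>Tensor products of operators\<close>

text \<open>First Q acts on the slices in the second variable, giving H. After swapping the
  coordinates, P acts on slices of the same kind, so \<open>ell2_prod_bound\<close> applies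
  twice.\<close>

lemma op_tensor_bounded:
  assumes P: "ell2_bounded_op P" and Q: "ell2_bounded_op Q"
  obtains K where "\<And>F. F \<in> ell2 \<Longrightarrow> op_tensor P Q F \<in> ell2"
    and "\<And>F. F \<in> ell2 \<Longrightarrow> (ell2_norm (op_tensor P Q F))\<^sup>2 \<le> K * (ell2_norm F)\<^sup>2"
proof -
  obtain C where C: "\<And>f. f \<in> ell2 \<Longrightarrow> ell2_norm (P f) \<le> C * ell2_norm f"
    using P unfolding ell2_bounded_op_def by blast
  obtain D where D: "\<And>f. f \<in> ell2 \<Longrightarrow> ell2_norm (Q f) \<le> D * ell2_norm f"
    using Q unfolding ell2_bounded_op_def by blast
  have "op_tensor P Q F \<in> ell2 \<and> (ell2_norm (op_tensor P Q F))\<^sup>2 \<le> (C\<^sup>2 * D\<^sup>2) * (ell2_norm F)\<^sup>2"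
    if F: "F \<in> ell2" for F
  proof -
    define H where "H = (\<lambda>(x, y). Q (\<lambda>y'. F (x, y')) y)"
    have Hx: "(\<lambda>y. H (x, y)) = Q (\<lambda>y'. F (x, y'))" for x by (simp add: H_def)
    have H: "H \<in> ell2" "(ell2_norm H)\<^sup>2 \<le> D\<^sup>2 * (ell2_norm F)\<^sup>2"
      using ell2_prod_bound[OF F, of H D] Q D ell2_fst_slice[OF F]
      by (auto simp: Hx ell2_bounded_op_def)
    define H' where "H' = (\<lambda>(y, x). H (x, y))"
    define G where "G = (\<lambda>(y, x). P (\<lambda>x'. H' (y, x')) x)"
    have H': "H' \<in> ell2" using H ell2_swap(1)[of H] by (simp add: H'_def)
    have Gy: "(\<lambda>x. G (y, x)) = P (\<lambda>x'. H' (y, x'))" for y by (simp add: G_def)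
    have G: "G \<in> ell2" "(ell2_norm G)\<^sup>2 \<le> C\<^sup>2 * (ell2_norm H')\<^sup>2"
      using ell2_prod_bound[OF H', of G C] P C ell2_fst_slice[OF H']
      by (auto simp: Gy ell2_bounded_op_def)
    have eq: "op_tensor P Q F = (\<lambda>(x, y). G (y, x))"
      by (simp add: op_tensor_def G_def H'_def H_def)
    have "(ell2_norm G)\<^sup>2 \<le> C\<^sup>2 * (D\<^sup>2 * (ell2_norm F)\<^sup>2)"
      using G(2) H(2) ell2_swap(2)[of H] mult_left_mono[OF H(2), of "C\<^sup>2"] by (simp add: H'_def)
    then show ?thesis
      using G ell2_swap[of G] by (simp add: eq mult.assoc)
  qed
  then show ?thesis using that by blast
qed

text \<open>This makes the supremum in \<open>ell2_onorm\<close> one over a bounded set, so that it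
  really dominates the norms of the image vectors. The size of K is irrelevant for that.\<close>

lemma sum_op_tensor_bounded:
  assumes \<pi>: "\<And>b. ell2_bounded_op (\<pi> b)" and \<rho>: "\<And>a. ell2_bounded_op (\<rho> a)"
  shows "\<exists>K\<ge>0. \<forall>F\<in>ell2. (\<lambda>z. \<Sum>(b, a)\<leftarrow>xs. op_tensor (\<pi> b) (\<rho> a) F z) \<in> ell2 \<and>
    (ell2_norm (\<lambda>z. \<Sum>(b, a)\<leftarrow>xs. op_tensor (\<pi> b) (\<rho> a) F z))\<^sup>2 \<le> K * (ell2_norm F)\<^sup>2"
proof (induction xs)
  case Nil
  show ?case by (intro exI[of _ 0]) (simp add: ell2_zero ell2_norm_def)
next
  case (Cons p xs)
  obtain b a where p: "p = (b, a)" by (cases p)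
  obtain K where K: "K \<ge> 0" "\<And>F. F \<in> ell2 \<Longrightarrow> (\<lambda>z. \<Sum>(b, a)\<leftarrow>xs. op_tensor (\<pi> b) (\<rho> a) F z) \<in> ell2"
    "\<And>F. F \<in> ell2 \<Longrightarrow>
      (ell2_norm (\<lambda>z. \<Sum>(b, a)\<leftarrow>xs. op_tensor (\<pi> b) (\<rho> a) F z))\<^sup>2 \<le> K * (ell2_norm F)\<^sup>2"
    using Cons by blast
  obtain L where L: "\<And>F. F \<in> ell2 \<Longrightarrow> op_tensor (\<pi> b) (\<rho> a) F \<in> ell2"
    "\<And>F. F \<in> ell2 \<Longrightarrow> (ell2_norm (op_tensor (\<pi> b) (\<rho> a) F))\<^sup>2 \<le> L * (ell2_norm F)\<^sup>2"
    using op_tensor_bounded[OF \<pi> \<rho>] by blast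
  show ?case
  proof (intro exI[of _ "2 * \<bar>L\<bar> + 2 * K"] conjI ballI)
    fix F :: "'b \<times> 'd \<Rightarrow> complex" assume F: "F \<in> ell2"
    note add = ell2_add[OF L(1)[OF F] K(2)[OF F]]
    show "(\<lambda>z. \<Sum>(b, a)\<leftarrow>p # xs. op_tensor (\<pi> b) (\<rho> a) F z) \<in> ell2"
      using add(1) by (simp add: p)
    have "L * (ell2_norm F)\<^sup>2 \<le> \<bar>L\<bar> * (ell2_norm F)\<^sup>2" by (simp add: mult_right_mono)
    then show "(ell2_norm (\<lambda>z. \<Sum>(b, a)\<leftarrow>p # xs. op_tensor (\<pi> b) (\<rho> a) F z))\<^sup>2
        \<le> (2 * \<bar>L\<bar> + 2 * K) * (ell2_norm F)\<^sup>2"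
      using add(2) L(2)[OF F] K(3)[OF F] by (simp add: p algebra_simps)
  qed (use K in simp)
qed

lemma op_tensor_product_vector:
  assumes P: "ell2_bounded_op P" and Q: "ell2_bounded_op Q" and f: "f \<in> ell2" and g: "g \<in> ell2"
  shows "op_tensor P Q (\<lambda>(x, y). f x * g y) = (\<lambda>(x, y). P f x * Q g y)"
proof -
  have Q1: "Q (\<lambda>y'. f x' * g y') = (\<lambda>y. f x' * Q g y)" for x'
    using Q g by (auto simp: ell2_bounded_op_def)
  have "P (\<lambda>x'. Q g y * f x') = (\<lambda>x. Q g y * P f x)" for y
    using P f by (auto simp: ell2_bounded_op_def)
  then show ?thesis by (simp add: op_tensor_def Q1 mult.commute fun_eq_iff)
qed

lemma ell2_product_vector:
  assumes f: "f \<in> ell2" and g: "g \<in> ell2"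
  shows "(\<lambda>(x, y). f x * g y) \<in> ell2"
    and "ell2_norm (\<lambda>(x, y). f x * g y) = ell2_norm f * ell2_norm g"
proof -
  let ?F = "\<lambda>(x, y). f x * g y"
  have n: "(ell2_norm (\<lambda>y. ?F (x, y)))\<^sup>2 = (cmod (f x))\<^sup>2 * (ell2_norm g)\<^sup>2" for x
    using ell2_scale(2)[OF g, of "f x"] by (simp add: power_mult_distrib)
  show mem: "?F \<in> ell2"
  proof (rule ell2_prodI)
    show "(\<lambda>x. (ell2_norm (\<lambda>y. ?F (x, y)))\<^sup>2) summable_on UNIV"
      unfolding n by (intro summable_on_cmult_left ell2_summable f)
  qed (use ell2_scale(1)[OF g] in simp)
  have "(ell2_norm ?F)\<^sup>2 = (ell2_norm f * ell2_norm g)\<^sup>2"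
    unfolding ell2_Fubini(2)[OF mem, symmetric] n
    by (simp add: infsum_cmult_left' ell2_norm_power2 power_mult_distrib)
  then show "ell2_norm ?F = ell2_norm f * ell2_norm g"
    by (simp add: power2_eq_iff_nonneg ell2_norm_nonneg)
qed

section \<open>Operator norms and the slice inequality\<close>

lemma ell2_norm_le_onorm:
  fixes P :: "('x \<Rightarrow> complex) \<Rightarrow> 'x \<Rightarrow> complex"
  assumes bd: "\<And>g. g \<in> ell2 \<Longrightarrow> (ell2_norm (P g))\<^sup>2 \<le> K * (ell2_norm g)\<^sup>2" and "0 \<le> K"
    and "f \<in> ell2" "ell2_norm f \<le> 1"
  shows "ell2_norm (P f) \<le> ell2_onorm P"
  unfolding ell2_onorm_def
proof (rule cSUP_upper)
  show "bdd_above ((\<lambda>f. ell2_norm (P f)) ` {f \<in> ell2. ell2_norm f \<le> 1})"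
  proof (rule bdd_aboveI2)
    fix g :: "'x \<Rightarrow> complex" assume "g \<in> {f \<in> ell2. ell2_norm f \<le> 1}"
    then have "(ell2_norm g)\<^sup>2 \<le> 1" and g: "g \<in> ell2" by (auto simp: ell2_norm_nonneg power_le_one)
    then have "(ell2_norm (P g))\<^sup>2 \<le> K * 1" using bd[OF g] \<open>0 \<le> K\<close> by (meson mult_left_mono order_trans)
    then show "ell2_norm (P g) \<le> sqrt K" using real_le_rsqrt by simp
  qed
qed (use assms(3,4) in simp)

lemma ell2_onorm_le:
  assumes "\<And>f. f \<in> ell2 \<Longrightarrow> ell2_norm f \<le> 1 \<Longrightarrow> ell2_norm (P f) \<le> C"
  shows "ell2_onorm P \<le> C"
  unfolding ell2_onorm_def
proof (rule cSUP_least)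
  have "(\<lambda>x. 0) \<in> {f \<in> ell2. ell2_norm f \<le> 1}" by (simp add: ell2_zero ell2_norm_def)
  then show "{f \<in> ell2. ell2_norm f \<le> 1} \<noteq> {}" by blast
qed (use assms in auto)

lemma faithful_rep_bounded: "faithful_rep \<pi> \<Longrightarrow> ell2_bounded_op (\<pi> a)"
  unfolding faithful_rep_def by blast

lemma faithful_rep_ell2: "faithful_rep \<pi> \<Longrightarrow> f \<in> ell2 \<Longrightarrow> \<pi> a f \<in> ell2"
  unfolding faithful_rep_def ell2_bounded_op_def by blast

lemma faithful_rep_norm: "faithful_rep \<pi> \<Longrightarrow> ell2_onorm (\<pi> a) = norm a"
  unfolding faithful_rep_def by blast

lemma faithful_rep_add:
  "faithful_rep \<pi> \<Longrightarrow> f \<in> ell2 \<Longrightarrow> \<pi> (a + b) f = (\<lambda>x. \<pi> a f x + \<pi> b f x)"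
  unfolding faithful_rep_def by blast

lemma faithful_rep_scale:
  "faithful_rep \<pi> \<Longrightarrow> f \<in> ell2 \<Longrightarrow> \<pi> (c *\<^sub>C a) f = (\<lambda>x. c * \<pi> a f x)"
  unfolding faithful_rep_def by blast

lemma faithful_rep_zero: "faithful_rep \<pi> \<Longrightarrow> f \<in> ell2 \<Longrightarrow> \<pi> 0 f = (\<lambda>x. 0)"
  using faithful_rep_scale[of \<pi> f 0 0] by simp

text \<open>The slice map is implemented by \<open>f \<mapsto> f \<otimes> \<xi>\<close> followed by pairing the second leg with \<open>\<eta>\<close>.\<close>

lemma slice_norm_le:
  fixes \<pi> :: "'b::cstar_algebra \<Rightarrow> ('x \<Rightarrow> complex) \<Rightarrow> 'x \<Rightarrow> complex"
    and \<rho> :: "'a::cstar_algebra \<Rightarrow> ('y \<Rightarrow> complex) \<Rightarrow> 'y \<Rightarrow> complex"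
  assumes \<pi>: "faithful_rep \<pi>" and \<rho>: "faithful_rep \<rho>"
    and \<xi>: "\<xi> \<in> ell2" "ell2_norm \<xi> \<le> 1" and \<eta>: "\<eta> \<in> ell2"
  shows "norm (\<Sum>(b, a)\<leftarrow>xs. ell2_inner \<eta> (\<rho> a \<xi>) *\<^sub>C b)
    \<le> ell2_norm \<eta> * ell2_onorm (\<lambda>F z. \<Sum>(b, a)\<leftarrow>xs. op_tensor (\<pi> b) (\<rho> a) F z)"
    (is "norm ?z \<le> _ * ell2_onorm ?M")
proof -
  obtain K where K: "K \<ge> 0" "\<And>F. F \<in> ell2 \<Longrightarrow> ?M F \<in> ell2"
    "\<And>F. F \<in> ell2 \<Longrightarrow> (ell2_norm (?M F))\<^sup>2 \<le> K * (ell2_norm F)\<^sup>2"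
    using sum_op_tensor_bounded[of \<pi> \<rho> xs, OF faithful_rep_bounded[OF \<pi>] faithful_rep_bounded[OF \<rho>]]
    by blast
  have "ell2_norm (\<pi> ?z f) \<le> ell2_norm \<eta> * ell2_onorm ?M" if f: "f \<in> ell2" "ell2_norm f \<le> 1" for f
  proof -
    define F where "F = (\<lambda>(x, y). f x * \<xi> y)"
    have F: "F \<in> ell2" "ell2_norm F \<le> 1"
      using ell2_product_vector[OF f(1) \<xi>(1)] mult_le_one[OF f(2) ell2_norm_nonneg \<xi>(2)]
      by (auto simp: F_def)
    have MF: "?M F (x, y) = (\<Sum>(b, a)\<leftarrow>xs. \<pi> b f x * \<rho> a \<xi> y)" for x y
      unfolding F_def
      by (simp add: op_tensor_product_vector[OF faithful_rep_bounded[OF \<pi>]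
          faithful_rep_bounded[OF \<rho>] f(1) \<xi>(1)])
    \<comment> \<open>Pairing the second leg of the image of f \<otimes> \<xi> with \<eta> gives the
      sliced element applied to f. What remains is Cauchy-Schwarz on each slice and summation over x
      by Fubini.\<close>
    have inner: "\<pi> ?z f x = ell2_inner \<eta> (\<lambda>y. ?M F (x, y))" for x
    proof -
      have "(\<lambda>y. \<Sum>(b, a)\<leftarrow>xs. \<pi> b f x * \<rho> a \<xi> y) \<in> ell2 \<and>
        \<pi> (\<Sum>(b, a)\<leftarrow>xs. ell2_inner \<eta> (\<rho> a \<xi>) *\<^sub>C b) f x
        = ell2_inner \<eta> (\<lambda>y. \<Sum>(b, a)\<leftarrow>xs. \<pi> b f x * \<rho> a \<xi> y)" for xs
      proof (induction xs)
        case Nil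
        show ?case by (simp add: faithful_rep_zero[OF \<pi> f(1)] ell2_inner_def ell2_zero)
      next
        case (Cons p xs)
        obtain b a where p: "p = (b, a)" by (cases p)
        have r: "(\<lambda>y. \<pi> b f x * \<rho> a \<xi> y) \<in> ell2"
          by (rule ell2_scale(1)[OF faithful_rep_ell2[OF \<rho> \<xi>(1)]])
        show ?case
          using Cons ell2_add(1)[OF r, of "\<lambda>y. \<Sum>(b, a)\<leftarrow>xs. \<pi> b f x * \<rho> a \<xi> y"]
          by (simp add: p faithful_rep_add[OF \<pi> f(1)] faithful_rep_scale[OF \<pi> f(1)]
              ell2_inner_add[OF \<eta> r] ell2_inner_scale mult.commute)
      qed
      then show ?thesis unfolding MF by blast
    qed
    have le: "(cmod (\<pi> ?z f x))\<^sup>2 \<le> (ell2_norm \<eta>)\<^sup>2 * (ell2_norm (\<lambda>y. ?M F (x, y)))\<^sup>2" for x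
      unfolding inner power_mult_distrib[symmetric]
      by (intro power_mono ell2_Cauchy_Schwarz \<eta> ell2_fst_slice[OF K(2)[OF F(1)]] norm_ge_zero)
    note MFl = K(2)[OF F(1)]
    have "(ell2_norm (\<pi> ?z f))\<^sup>2
        \<le> (\<Sum>\<^sub>\<infinity>x. (ell2_norm \<eta>)\<^sup>2 * (ell2_norm (\<lambda>y. ?M F (x, y)))\<^sup>2)"
      unfolding ell2_norm_power2[of "\<pi> ?z f"]
      by (rule infsum_mono[OF ell2_summable[OF faithful_rep_ell2[OF \<pi> f(1)]]
            summable_on_cmult_right[OF ell2_Fubini(1)[OF MFl]] le])
    also have "\<dots> = (ell2_norm \<eta> * ell2_norm (?M F))\<^sup>2"
      unfolding infsum_cmult_right' ell2_Fubini(2)[OF MFl] by (simp add: power_mult_distrib)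
    finally have "ell2_norm (\<pi> ?z f) \<le> ell2_norm \<eta> * ell2_norm (?M F)"
      by (rule power2_le_imp_le) (simp add: ell2_norm_nonneg)
    also have "\<dots> \<le> ell2_norm \<eta> * ell2_onorm ?M"
      by (intro mult_left_mono ell2_norm_nonneg ell2_norm_le_onorm[of ?M K, OF K(3) K(1) F])
    finally show ?thesis .
  qed
  then have "ell2_onorm (\<pi> ?z) \<le> ell2_norm \<eta> * ell2_onorm ?M" by (rule ell2_onorm_le)
  then show ?thesis by (simp add: faithful_rep_norm[OF \<pi>])
qed

text \<open>Taking \<eta> = \<open>\<rho> d \<xi>\<close> turns the hypothesis into a bound of the
  squared norm of this vector by \<epsilon> times its norm.\<close>

lemma norm_le_of_matrix_coefficients:
  fixes \<rho> :: "'a::cstar_algebra \<Rightarrow> ('y \<Rightarrow> complex) \<Rightarrow> 'y \<Rightarrow> complex"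
  assumes \<rho>: "faithful_rep \<rho>"
    and le: "\<And>\<eta> \<xi>. \<eta> \<in> ell2 \<Longrightarrow> \<xi> \<in> ell2 \<Longrightarrow> ell2_norm \<xi> \<le> 1 \<Longrightarrow>
      cmod (ell2_inner \<eta> (\<rho> d \<xi>)) \<le> ell2_norm \<eta> * \<epsilon>"
    and "0 \<le> \<epsilon>"
  shows "norm d \<le> \<epsilon>"
proof -
  have "ell2_norm (\<rho> d \<xi>) \<le> \<epsilon>" if \<xi>: "\<xi> \<in> ell2" "ell2_norm \<xi> \<le> 1" for \<xi>
  proof -
    let ?n = "ell2_norm (\<rho> d \<xi>)"
    have "?n * ?n \<le> ?n * \<epsilon>"
      using le[OF faithful_rep_ell2[OF \<rho> \<xi>(1)] \<xi>, of d]
      by (simp add: ell2_inner_self faithful_rep_ell2[OF \<rho> \<xi>(1)] norm_power power2_eq_square norm_mult ell2_norm_nonneg)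
    then show ?thesis using \<open>0 \<le> \<epsilon>\<close> ell2_norm_nonneg[of "\<rho> d \<xi>"] by (cases "?n = 0") auto
  qed
  then have "ell2_onorm (\<rho> d) \<le> \<epsilon>" by (rule ell2_onorm_le)
  then show ?thesis by (simp add: faithful_rep_norm[OF \<rho>])
qed

section \<open>Words in the generators of the Cuntz algebra\<close>

lemma scaleC_left_minus: "(- c) *\<^sub>C x = - (c *\<^sub>C (x::'a::cstar_algebra))"
  using scaleC_add_left[of c "- c" x] by (simp add: eq_neg_iff_add_eq_0 add.commute)

lemma scaleC_sum_left: "(\<Sum>i\<in>I. c i) *\<^sub>C x = (\<Sum>i\<in>I. c i *\<^sub>C (x::'a::cstar_algebra))"
  by (induction I rule: infinite_finite_induct) (simp_all add: scaleC_add_left)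

lemma ell2_coefficient_add:
  assumes "faithful_rep \<rho>" "\<eta> \<in> ell2" "\<xi> \<in> ell2"
  shows "ell2_inner \<eta> (\<rho> (a + b) \<xi>) = ell2_inner \<eta> (\<rho> a \<xi>) + ell2_inner \<eta> (\<rho> b \<xi>)"
  by (simp add: faithful_rep_add assms ell2_inner_add faithful_rep_ell2)

lemma ell2_coefficient_scale:
  assumes "faithful_rep \<rho>" "\<xi> \<in> ell2"
  shows "ell2_inner \<eta> (\<rho> (c *\<^sub>C a) \<xi>) = c * ell2_inner \<eta> (\<rho> a \<xi>)"
  by (simp add: faithful_rep_scale assms ell2_inner_scale)

lemma ell2_coefficient_zero:
  assumes "faithful_rep \<rho>" "\<xi> \<in> ell2"
  shows "ell2_inner \<eta> (\<rho> 0 \<xi>) = 0"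
  using ell2_coefficient_scale[OF assms, of \<eta> 0 0] by simp

lemma ell2_coefficient_sum:
  assumes "faithful_rep \<rho>" "\<eta> \<in> ell2" "\<xi> \<in> ell2"
  shows "ell2_inner \<eta> (\<rho> (\<Sum>i\<in>I. a i) \<xi>) = (\<Sum>i\<in>I. ell2_inner \<eta> (\<rho> (a i) \<xi>))"
  by (induction I rule: infinite_finite_induct)
     (simp_all add: ell2_coefficient_add ell2_coefficient_zero assms)

text \<open>At a vector \<xi> the sum becomes the sum of the squared norms of
  \<open>\<rho> (x i) \<xi>\<close>, all of which must vanish. The faithful representation thus
  stands in for the order theory of positive elements.\<close>

lemma sum_star_mult_eq_0D:
  assumes \<rho>: "faithful_rep (\<rho> :: 'a::cstar_algebra \<Rightarrow> ('y \<Rightarrow> complex) \<Rightarrow> 'y \<Rightarrow> complex)"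
    and "finite I" and zero: "(\<Sum>i\<in>I. star (x i) * x i) = 0" and i: "i \<in> I"
  shows "x i = (0::'a)"
proof -
  have "ell2_norm (\<rho> (x i) \<xi>) \<le> 0" if \<xi>: "\<xi> \<in> ell2" for \<xi>
  proof -
    have sq: "ell2_inner \<xi> (\<rho> (star y * y) \<xi>) = complex_of_real ((ell2_norm (\<rho> y \<xi>))\<^sup>2)" for y
    proof -
      have adj: "\<And>a f g. f \<in> ell2 \<Longrightarrow> g \<in> ell2 \<Longrightarrow>
          ell2_inner (\<rho> (star a) f) g = ell2_inner f (\<rho> a g)"
        and mult: "\<And>a b. \<rho> (a * b) \<xi> = \<rho> a (\<rho> b \<xi>)"
        using \<rho> \<xi> unfolding faithful_rep_def by blast+
      have "ell2_inner \<xi> (\<rho> (star y) (\<rho> y \<xi>)) = ell2_inner (\<rho> y \<xi>) (\<rho> y \<xi>)"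
        using adj[OF \<xi> faithful_rep_ell2[OF \<rho> \<xi>], of "star y" y] by (simp add: star_star)
      then show ?thesis by (simp add: mult ell2_inner_self faithful_rep_ell2[OF \<rho> \<xi>])
    qed
    have "complex_of_real (\<Sum>i\<in>I. (ell2_norm (\<rho> (x i) \<xi>))\<^sup>2) = 0"
      using ell2_coefficient_sum[OF \<rho> \<xi> \<xi>, of "\<lambda>i. star (x i) * x i" I]
      by (simp add: zero ell2_coefficient_zero[OF \<rho> \<xi>] sq)
    then have "(\<Sum>i\<in>I. (ell2_norm (\<rho> (x i) \<xi>))\<^sup>2) = 0" using of_real_eq_0_iff by blast
    then have "(ell2_norm (\<rho> (x i) \<xi>))\<^sup>2 = 0"
      using sum_nonneg_eq_0_iff[OF \<open>finite I\<close>, of "\<lambda>i. (ell2_norm (\<rho> (x i) \<xi>))\<^sup>2"] i by simp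
    then show ?thesis by simp
  qed
  then have "ell2_onorm (\<rho> (x i)) \<le> 0" by (intro ell2_onorm_le)
  then show ?thesis by (simp add: faithful_rep_norm[OF \<rho>])
qed

section \<open>Cuntz families and orthogonality of their ranges\<close>

definition cuntz_family :: "('n::finite \<Rightarrow> 'a::cstar_algebra) \<Rightarrow> bool" where
  "cuntz_family S \<longleftrightarrow> (\<forall>i j. star (S i) * S j = (if i = j then 1 else 0)) \<and>
     (\<Sum>j\<in>UNIV. S j * star (S j)) = 1"

text \<open>Only orthogonality has to be derived. Putting the sum relation between
  \<open>star (S j)\<close> and \<open>S j\<close> shows that the elements
  \<open>star (S i) * S j\<close> have squares \<open>star x * x\<close> summing to 1. The term i =
  j is already 1, so the others sum to 0 and vanish.\<close>

lemma cuntz_algebra_cuntz_family: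
  fixes \<rho> :: "'a::cstar_algebra \<Rightarrow> ('y \<Rightarrow> complex) \<Rightarrow> 'y \<Rightarrow> complex"
  assumes "cuntz_algebra (S :: 'n::finite \<Rightarrow> 'a)" and \<rho>: "faithful_rep \<rho>"
  shows "cuntz_family S"
proof -
  have rel: "poly_eval S r = 0" if "r \<in> cuntz_relations" for r
    using assms(1) that by (simp add: cuntz_algebra_def universal_cstar_def)
  have iso: "star (S i) * S i = 1" for i
  proof -
    have "poly_star (gen i) * gen i - 1 \<in> cuntz_relations" by (auto simp: cuntz_relations_def)
    from rel[OF this] show ?thesis by (simp add: poly_eval_diff poly_eval_mult poly_eval_star)
  qed
  have sum: "(\<Sum>j\<in>UNIV. S j * star (S j)) = 1"
  proof -
    have "(\<Sum>j\<in>UNIV. gen j * poly_star (gen j)) - 1 \<in> (cuntz_relations :: 'n star_poly set)"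
      by (simp add: cuntz_relations_def)
    from rel[OF this] show ?thesis
      by (simp add: poly_eval_diff poly_eval_sum poly_eval_mult poly_eval_star)
  qed
  have orth: "star (S i) * S j = 0" if "i \<noteq> j" for i j
  proof -
    let ?x = "\<lambda>i. star (S i) * S j"
    have "(\<Sum>i\<in>UNIV. star (?x i) * ?x i) = star (S j) * (\<Sum>i\<in>UNIV. S i * star (S i)) * S j"
      by (simp add: star_mult star_star sum_distrib_left sum_distrib_right mult.assoc)
    also have "\<dots> = 1" by (simp add: sum iso)
    finally have "(\<Sum>i\<in>UNIV - {j}. star (?x i) * ?x i) = 0"
      by (simp add: sum_diff1 iso)
    from sum_star_mult_eq_0D[OF \<rho> _ this] that show ?thesis by simp
  qed
  show ?thesis using iso sum orth by (simp add: cuntz_family_def)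
qed

section \<open>Words and their linear span\<close>

definition word :: "('n \<Rightarrow> 'a::cstar_algebra) \<Rightarrow> 'n list \<Rightarrow> 'a" where
  "word S \<alpha> = prod_list (map S \<alpha>)"

lemma word_Nil [simp]: "word S [] = 1" and word_Cons [simp]: "word S (i # \<alpha>) = S i * word S \<alpha>"
  and word_snoc: "word S (\<alpha> @ [i]) = word S \<alpha> * S i"
  by (simp_all add: word_def)

lemma sum_lists_Suc:
  "(\<Sum>\<alpha> | length \<alpha> = Suc n. f \<alpha>) = (\<Sum>i\<in>UNIV. \<Sum>\<alpha> | length \<alpha> = n. f ((i::'n::finite) # \<alpha>))"
proof -
  have "{\<alpha>::'n list. length \<alpha> = Suc n} = (\<lambda>p. fst p # snd p) ` (UNIV \<times> {\<alpha>. length \<alpha> = n})"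
    by (force simp: length_Suc_conv)
  moreover have "inj_on (\<lambda>p. fst p # snd p) (UNIV \<times> {\<alpha>::'n list. length \<alpha> = n})"
    by (auto simp: inj_on_def)
  ultimately show ?thesis by (simp add: sum.reindex sum.cartesian_product case_prod_beta)
qed

lemma finite_lists_of_length: "finite {\<alpha>::'n::finite list. length \<alpha> = n}"
  using finite_lists_length_eq[of "UNIV :: 'n set" n] by simp

lemma word_orthogonal:
  assumes "cuntz_family S" "length \<alpha> = length \<beta>"
  shows "star (word S \<alpha>) * word S \<beta> = (if \<alpha> = \<beta> then 1 else 0)"
  using assms(2)
proof (induction \<alpha> \<beta> rule: list_induct2)
  case (Cons i \<alpha> j \<beta>)
  have "star (word S (i # \<alpha>)) * word S (j # \<beta>)
      = star (word S \<alpha>) * (star (S i) * S j) * word S \<beta>"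
    by (simp add: star_mult mult.assoc)
  also have "star (S i) * S j = (if i = j then 1 else 0)" using assms(1) by (simp add: cuntz_family_def)
  finally show ?case using Cons.IH by (cases "i = j") simp_all
qed simp

lemma word_complete:
  assumes "cuntz_family S"
  shows "(\<Sum>\<alpha> | length \<alpha> = n. word S \<alpha> * star (word S \<alpha>)) = 1"
proof (induction n)
  case (Suc n)
  have "(\<Sum>\<alpha> | length \<alpha> = Suc n. word S \<alpha> * star (word S \<alpha>))
      = (\<Sum>i\<in>UNIV. S i * (\<Sum>\<alpha> | length \<alpha> = n. word S \<alpha> * star (word S \<alpha>)) * star (S i))"
    by (simp add: sum_lists_Suc star_mult sum_distrib_left sum_distrib_right mult.assoc)
  then show ?case using assms by (simp add: Suc cuntz_family_def)
qed simp

text \<open>The explicit list keeps the finitely many words of a combination in view, from which a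
  common bound on their lengths is read off later.\<close>

definition word_span :: "('n \<Rightarrow> 'a::cstar_algebra) \<Rightarrow> 'a set" where
  "word_span S = {\<Sum>(c, \<alpha>, \<beta>)\<leftarrow>xs. c *\<^sub>C (word S \<alpha> * star (word S \<beta>)) | xs. True}"

lemma word_span_word: "c *\<^sub>C (word S \<alpha> * star (word S \<beta>)) \<in> word_span S"
  unfolding word_span_def mem_Collect_eq by (intro exI[of _ "[(c, \<alpha>, \<beta>)]"]) simp

lemma word_span_zero: "0 \<in> word_span S"
  using word_span_word[of 0] by simp

lemma word_span_add:
  assumes "x \<in> word_span S" "y \<in> word_span S"
  shows "x + y \<in> word_span S"
proof -
  obtain xs ys where "x = (\<Sum>(c, \<alpha>, \<beta>)\<leftarrow>xs. c *\<^sub>C (word S \<alpha> * star (word S \<beta>)))"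
    "y = (\<Sum>(c, \<alpha>, \<beta>)\<leftarrow>ys. c *\<^sub>C (word S \<alpha> * star (word S \<beta>)))"
    using assms by (auto simp: word_span_def)
  then show ?thesis unfolding word_span_def mem_Collect_eq by (intro exI[of _ "xs @ ys"]) simp
qed

lemma word_span_image:
  assumes "x \<in> word_span S"
    and "f 0 = 0" "\<And>x y. f (x + y) = f x + f y"
    and "\<And>c \<alpha> \<beta>. f (c *\<^sub>C (word S \<alpha> * star (word S \<beta>))) \<in> word_span S"
  shows "f x \<in> word_span S"
proof -
  obtain xs where x: "x = (\<Sum>(c, \<alpha>, \<beta>)\<leftarrow>xs. c *\<^sub>C (word S \<alpha> * star (word S \<beta>)))"
    using assms(1) by (auto simp: word_span_def)
  show ?thesis unfolding x
    by (induction xs) (auto simp: assms word_span_zero word_span_add)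
qed

text \<open>Left multiplication by \<open>S j\<close> prepends a letter to \<alpha>. Left
  multiplication by \<open>star (S j)\<close> removes or kills the first letter of \<alpha>, or
  appends j to \<beta> when \<alpha> is empty. Hence the span absorbs every letter of a
  *-word.\<close>

lemma poly_eval_in_word_span:
  assumes S: "cuntz_family S"
  shows "poly_eval S f \<in> word_span S"
proof -
  have left: "S j * x \<in> word_span S" if "x \<in> word_span S" for x j
  proof (rule word_span_image[OF that])
    fix c \<alpha> \<beta>
    have "S j * (c *\<^sub>C (word S \<alpha> * star (word S \<beta>))) = c *\<^sub>C (word S (j # \<alpha>) * star (word S \<beta>))"
      by (simp add: mult_scaleC_right mult.assoc)
    then show "S j * (c *\<^sub>C (word S \<alpha> * star (word S \<beta>))) \<in> word_span S"
      by (simp only: word_span_word)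
  qed (simp_all add: distrib_left)
  have left_star: "star (S j) * x \<in> word_span S" if "x \<in> word_span S" for x j
  proof (rule word_span_image[OF that])
    fix c \<alpha> \<beta>
    show "star (S j) * (c *\<^sub>C (word S \<alpha> * star (word S \<beta>))) \<in> word_span S"
    proof (cases \<alpha>)
      case Nil
      have "star (S j) * (c *\<^sub>C (word S \<alpha> * star (word S \<beta>)))
          = c *\<^sub>C (word S [] * star (word S (\<beta> @ [j])))"
        by (simp add: Nil word_snoc star_mult mult_scaleC_right)
      then show ?thesis by (simp only: word_span_word)
    next
      case (Cons i \<alpha>')
      have "star (S j) * (c *\<^sub>C (word S \<alpha> * star (word S \<beta>)))
          = c *\<^sub>C ((star (S j) * S i) * (word S \<alpha>' * star (word S \<beta>)))"
        by (simp add: Cons mult_scaleC_right mult.assoc)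
      also have "star (S j) * S i = (if j = i then 1 else 0)" using S by (simp add: cuntz_family_def)
      finally show ?thesis using word_span_word word_span_zero by (cases "j = i") simp_all
    qed
  qed (simp_all add: distrib_left)
  have word: "word_eval S w \<in> word_span S" for w
  proof -
    have "prod_list (map (\<lambda>(x, s). if s then star (S x) else S x) ls) \<in> word_span S" for ls
    proof (induction ls)
      case Nil
      show ?case using word_span_word[of 1 S "[]" "[]"] by simp
    next
      case (Cons p ls)
      then show ?case by (cases p) (auto simp: left left_star)
    qed
    then show ?thesis by (simp add: word_eval_def)
  qed
  have "c *\<^sub>C x \<in> word_span S" if "x \<in> word_span S" for c x
  proof (rule word_span_image[OF that])
    fix d \<alpha> \<beta>
    show "c *\<^sub>C (d *\<^sub>C (word S \<alpha> * star (word S \<beta>))) \<in> word_span S"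
      unfolding scaleC_scaleC by (rule word_span_word)
  qed (simp_all add: scaleC_add_right)
  then show ?thesis
    by (induction f rule: star_poly_induct)
       (simp_all add: word_span_zero poly_eval_add poly_eval_single word_span_add word)
qed

section \<open>The coaction on words\<close>

lemma coaction_word:
  assumes hom: "unital_star_hom \<phi>" and \<phi>: "\<And>i. \<phi> (S i) = (\<Sum>j\<in>UNIV. tens (u i j) (S j))"
    and mult: "\<And>b b' a a'. tens b a * tens b' a' = tens (b * b') (a * a')" and one: "tens 1 1 = 1"
  shows "\<phi> (word S \<alpha>) = (\<Sum>\<gamma> | length \<gamma> = length \<alpha>.
    tens (prod_list (map2 u \<alpha> \<gamma>)) (word S (\<gamma> :: 'n::finite list)))"
proof (induction \<alpha>)
  case Nil
  then show ?case using hom by (simp add: unital_star_hom_def one)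
next
  case (Cons i \<alpha>)
  have "\<phi> (word S (i # \<alpha>)) = \<phi> (S i) * \<phi> (word S \<alpha>)"
    using hom by (simp add: unital_star_hom_def)
  then show ?case by (simp add: Cons \<phi> sum_lists_Suc sum_product mult)
qed

lemma coaction_word_star_word:
  assumes hom: "unital_star_hom \<phi>" and \<phi>: "\<And>i. \<phi> (S i) = (\<Sum>j\<in>UNIV. tens (u i j) (S j))"
    and mult: "\<And>b b' a a'. tens b a * tens b' a' = tens (b * b') (a * a')" and one: "tens 1 1 = 1"
    and star: "\<And>b a. star (tens b a) = tens (star b) (star a)"
  shows "\<phi> (word S \<alpha> * star (word S \<beta>)) = (\<Sum>\<gamma> | length \<gamma> = length \<alpha>. \<Sum>\<delta> | length \<delta> = length \<beta>.
    tens (prod_list (map2 u \<alpha> \<gamma>) * star (prod_list (map2 u \<beta> \<delta>)))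
      (word S \<gamma> * star (word S (\<delta> :: 'n::finite list))))"
proof -
  have "\<phi> (word S \<alpha> * star (word S \<beta>)) = \<phi> (word S \<alpha>) * star (\<phi> (word S \<beta>))"
    using hom by (simp add: unital_star_hom_def)
  then show ?thesis
    unfolding coaction_word[where \<phi> = \<phi>, OF hom \<phi> mult one] star_sum sum_product star mult .
qed

section \<open>Weighted cyclic shifts\<close>

text \<open>The products \<open>T a * star (T b)\<close> with a, b < m form a system of m by m
  matrix units with sum of the diagonal equal to 1.\<close>

locale cuntz_tuple =
  fixes m :: nat and T :: "nat \<Rightarrow> 'a::cstar_algebra"
  assumes orth: "a < m \<Longrightarrow> b < m \<Longrightarrow> star (T a) * T b = (if a = b then 1 else 0)"
    and complete: "(\<Sum>a<m. T a * star (T a)) = 1" and m_pos: "0 < m"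
begin

text \<open>In terms of these matrix units, this is the diagonal matrix with entries
  \<open>w a\<close> times the k-th power of the cyclic shift.\<close>

definition shift_op :: "(nat \<Rightarrow> complex) \<Rightarrow> nat \<Rightarrow> 'a" where
  "shift_op w k = (\<Sum>a<m. w a *\<^sub>C (T a * star (T ((a + k) mod m))))"

text \<open>By \<open>complete\<close>, an element is recovered from its rows
  \<open>star (T a) * x\<close>; identities between weighted shifts can therefore be checked row by
  row.\<close>

lemma eqI:
  assumes "\<And>a. a < m \<Longrightarrow> star (T a) * x = star (T a) * y"
  shows "x = y"
proof -
  have "z = (\<Sum>a<m. T a * (star (T a) * z))" for z
    by (simp flip: mult.assoc sum_distrib_right add: complete)
  then show ?thesis using assms by (metis (no_types, lifting) lessThan_iff sum.cong)
qed

lemma star_T_shift_op: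
  assumes "a < m"
  shows "star (T a) * shift_op w k = w a *\<^sub>C star (T ((a + k) mod m))"
proof -
  have "star (T a) * shift_op w k
      = (\<Sum>b<m. w b *\<^sub>C ((star (T a) * T b) * star (T ((b + k) mod m))))"
    by (simp add: shift_op_def sum_distrib_left mult_scaleC_right mult.assoc)
  also have "\<dots> = (\<Sum>b<m. if a = b then w a *\<^sub>C star (T ((a + k) mod m)) else 0)"
    using assms by (intro sum.cong) (auto simp: orth)
  finally show ?thesis using assms by simp
qed

lemma star_shift_op_T:
  assumes "a < m"
  shows "star (shift_op w k) * T a = cnj (w a) *\<^sub>C T ((a + k) mod m)"
  using arg_cong[OF star_T_shift_op[OF assms, of w k], of star]
  by (simp add: star_mult star_star star_scaleC)

text \<open>Moving the second diagonal past k steps of the shift translates its argument by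
  k.\<close>

lemma shift_op_mult:
  "shift_op w k * shift_op w' k' = shift_op (\<lambda>a. w a * w' ((a + k) mod m)) (k + k')"
proof (rule eqI)
  fix a assume a: "a < m"
  have "star (T a) * (shift_op w k * shift_op w' k')
      = w a *\<^sub>C (star (T ((a + k) mod m)) * shift_op w' k')"
    by (simp flip: mult.assoc add: star_T_shift_op a mult_scaleC_left)
  then show "star (T a) * (shift_op w k * shift_op w' k')
      = star (T a) * shift_op (\<lambda>a. w a * w' ((a + k) mod m)) (k + k')"
    by (simp add: star_T_shift_op a m_pos scaleC_scaleC mod_simps add.assoc)
qed

lemma shift_op_one: "shift_op (\<lambda>a. 1) 0 = 1"
  by (simp add: shift_op_def complete)

lemma inj_on_shift: "inj_on (\<lambda>a. (a + k) mod m) {..<m}"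
proof (rule inj_onI)
  have *: "b \<le> a" if "a \<le> b" "b < m" "(a + k) mod m = (b + k) mod m" for a b
  proof -
    have "m dvd b - a" using that mod_eq_dvd_iff_nat[of "a + k" "b + k" m] by simp
    then show ?thesis using \<open>b < m\<close> by (meson diff_is_0_eq dvd_imp_le leD less_imp_diff_less neq0_conv)
  qed
  fix a b assume "a \<in> {..<m}" "b \<in> {..<m}" "(a + k) mod m = (b + k) mod m"
  then show "a = b" using *[of a b] *[of b a] by (metis lessThan_iff nle_le)
qed

lemma bij_betw_shift: "bij_betw (\<lambda>a. (a + k) mod m) {..<m} {..<m}"
  unfolding bij_betw_def
  by (intro conjI inj_on_shift endo_inj_surj) (auto simp: m_pos)

lemma shift_op_mult_star:
  "shift_op w k * star (shift_op w k) = (\<Sum>a<m. (w a * cnj (w a)) *\<^sub>C (T a * star (T a)))"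
proof -
  have "shift_op w k * T ((a + k) mod m) = w a *\<^sub>C T a" if a: "a < m" for a
  proof (rule eqI)
    fix b assume b: "b < m"
    have "(b + k) mod m = (a + k) mod m \<longleftrightarrow> b = a"
      using inj_onD[OF inj_on_shift[of k], of b a] a b by auto
    then show "star (T b) * (shift_op w k * T ((a + k) mod m)) = star (T b) * (w a *\<^sub>C T a)"
      using a b m_pos
      by (auto simp flip: mult.assoc simp: star_T_shift_op mult_scaleC_left mult_scaleC_right orth)
  qed
  note * = this
  have "star (T ((a + k) mod m)) * star (shift_op w k) = cnj (w a) *\<^sub>C star (T a)" if "a < m" for a
    using arg_cong[OF *[OF that], of star] by (simp add: star_mult star_scaleC)
  then have "shift_op w k * star (shift_op w k)
      = (\<Sum>a<m. w a *\<^sub>C (T a * (cnj (w a) *\<^sub>C star (T a))))"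
    by (subst (1) shift_op_def) (simp add: sum_distrib_right mult_scaleC_left mult.assoc)
  then show ?thesis by (simp add: mult_scaleC_right scaleC_scaleC)
qed

text \<open>The weights are those of \<open>shift_op_mult_star\<close>, but they sit on the diagonal
  units k places further on, where the shift arrives.\<close>

lemma star_shift_op_mult:
  "star (shift_op w k) * shift_op w k
    = (\<Sum>a<m. (w a * cnj (w a)) *\<^sub>C (T ((a + k) mod m) * star (T ((a + k) mod m))))"
proof -
  have "star (shift_op w k) * shift_op w k
      = (\<Sum>a<m. w a *\<^sub>C ((star (shift_op w k) * T a) * star (T ((a + k) mod m))))"
    by (subst (2) shift_op_def) (simp add: sum_distrib_left mult_scaleC_right mult.assoc)
  then show ?thesis by (simp add: star_shift_op_T mult_scaleC_left scaleC_scaleC)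
qed

text \<open>The assumption says that each weight is 0 or has modulus 1. The product with the adjoint
  is then the diagonal projection onto the support of w, which fixes the operator.\<close>

lemma shift_op_partial_isometry:
  assumes "\<And>a. w a * cnj (w a) * w a = w a"
  shows "shift_op w k * star (shift_op w k) * shift_op w k = shift_op w k"
proof (rule eqI)
  fix a assume a: "a < m"
  have "star (T a) * (\<Sum>b<m. (w b * cnj (w b)) *\<^sub>C (T b * star (T b)))
      = (\<Sum>b<m. if a = b then (w a * cnj (w a)) *\<^sub>C star (T a) else 0)"
    unfolding sum_distrib_left
    by (intro sum.cong) (auto simp: mult_scaleC_right orth a simp flip: mult.assoc)
  then have "star (T a) * (shift_op w k * star (shift_op w k)) = (w a * cnj (w a)) *\<^sub>C star (T a)"
    using a by (simp add: shift_op_mult_star)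
  then have "star (T a) * (shift_op w k * star (shift_op w k) * shift_op w k)
      = (w a * cnj (w a) * w a) *\<^sub>C star (T ((a + k) mod m))"
    using a by (simp flip: mult.assoc add: mult_scaleC_left star_T_shift_op scaleC_scaleC)
  then show "star (T a) * (shift_op w k * star (shift_op w k) * shift_op w k)
      = star (T a) * shift_op w k"
    by (simp only: assms star_T_shift_op[OF a])
qed

end

section \<open>Monomial models of the quantum symmetry algebra\<close>

text \<open>A pair \<open>(\<sigma>, z)\<close> encodes the signed permutation matrix with entries \<open>z i\<close> at \<open>(i, \<sigma> i)\<close>.\<close>

definition signed_perms :: "(('n::finite \<Rightarrow> 'n) \<times> ('n \<Rightarrow> bool)) set" where
  "signed_perms = {\<sigma>. bij \<sigma>} \<times> UNIV"

definition entry :: "('n \<Rightarrow> 'n) \<times> ('n \<Rightarrow> bool) \<Rightarrow> 'n \<Rightarrow> 'n \<Rightarrow> complex" where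
  "entry \<kappa> i j = (if fst \<kappa> i = j then if snd \<kappa> i then 1 else - 1 else 0)"

lemma finite_signed_perms: "finite signed_perms"
  by (rule finite_subset[OF subset_UNIV]) simp

lemma signed_perms_nonempty: "signed_perms \<noteq> {}"
proof -
  have "(id, \<lambda>_. True) \<in> signed_perms" by (simp add: signed_perms_def)
  then show ?thesis by blast
qed

lemma entry_cnj [simp]: "cnj (entry \<kappa> i j) = entry \<kappa> i j"
  by (simp add: entry_def)

lemma entry_square: "entry \<kappa> i j * entry \<kappa> i j = (if fst \<kappa> i = j then 1 else 0)"
  by (simp add: entry_def)

text \<open>These are orthogonality relations over the signed permutation matrices. Different rows
  are separated by a sign flip, and different columns of one row are never both nonzero. Exchanging
  two columns shows that the remaining value does not depend on j, so it is written with j =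
  i.\<close>

lemma sum_entry_products:
  "(\<Sum>\<kappa>\<in>signed_perms. entry \<kappa> i j * entry \<kappa> i' j')
    = (if i = i' \<and> j = j' then \<Sum>\<kappa>\<in>signed_perms. entry \<kappa> i i * entry \<kappa> i i else 0)"
proof (cases "i = i'")
  case False
  \<comment> \<open>flipping the sign in row \<open>i\<close> reverses the sign of every summand\<close>
  define f :: "('a \<Rightarrow> 'a) \<times> ('a \<Rightarrow> bool) \<Rightarrow> _" where "f = (\<lambda>(\<sigma>, z). (\<sigma>, z(i := \<not> z i)))"
  have ff: "f (f \<kappa>) = \<kappa>" for \<kappa> by (cases \<kappa>) (simp add: f_def)
  have "(\<Sum>\<kappa>\<in>signed_perms. entry \<kappa> i j * entry \<kappa> i' j')
      = (\<Sum>\<kappa>\<in>signed_perms. entry (f \<kappa>) i j * entry (f \<kappa>) i' j')"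
    by (rule sum.reindex_bij_witness[of _ f f]) (auto simp: ff, auto simp: f_def signed_perms_def)
  also have "\<dots> = (\<Sum>\<kappa>\<in>signed_perms. - (entry \<kappa> i j * entry \<kappa> i' j'))"
    using False by (intro sum.cong) (auto simp: f_def entry_def)
  finally show ?thesis using False by (simp add: sum_negf)
next
  case True
  show ?thesis
  proof (cases "j = j'")
    case False
    then have "(\<Sum>\<kappa>\<in>signed_perms. entry \<kappa> i j * entry \<kappa> i' j') = 0"
      using True by (intro sum.neutral) (auto simp: entry_def)
    then show ?thesis using False by simp
  next
    case j: True
    define f :: "('a \<Rightarrow> 'a) \<times> ('a \<Rightarrow> bool) \<Rightarrow> _"
      where "f = (\<lambda>(\<sigma>, z). (Transposition.transpose i j \<circ> \<sigma>, z))"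
    have ff: "f (f \<kappa>) = \<kappa>" for \<kappa> by (cases \<kappa>) (simp add: f_def fun_eq_iff)
    have "f \<kappa> \<in> signed_perms" if "\<kappa> \<in> signed_perms" for \<kappa>
      using that by (auto simp: f_def signed_perms_def intro!: bij_comp)
    then have "(\<Sum>\<kappa>\<in>signed_perms. entry \<kappa> i j * entry \<kappa> i j)
        = (\<Sum>\<kappa>\<in>signed_perms. entry (f \<kappa>) i j * entry (f \<kappa>) i j)"
      by (intro sum.reindex_bij_witness[of _ f f]) (auto simp: ff)
    also have "\<dots> = (\<Sum>\<kappa>\<in>signed_perms. entry \<kappa> i i * entry \<kappa> i i)"
      by (intro sum.cong) (auto simp: f_def entry_square Transposition.transpose_def split: if_splits)
    finally show ?thesis using True j by simp
  qed
qed

lemma poly_eval_prod_list: "poly_eval g (prod_list xs) = prod_list (map (poly_eval g) xs)"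
  by (induction xs) (simp_all add: poly_eval_mult)

section \<open>The models, their relations and their corner coefficients\<close>

context cuntz_tuple
begin

definition model :: "(nat \<Rightarrow> ('n \<Rightarrow> 'n) \<times> ('n \<Rightarrow> bool)) \<Rightarrow> 'n \<Rightarrow> 'n \<Rightarrow> 'a" where
  "model g i j = shift_op (\<lambda>a. entry (g a) i j) 1"

text \<open>Over each member \<open>E a\<close> of the orthogonal partition of unity sits the
  permutation matrix of \<open>\<sigma> a\<close>. Being a magic unitary is checked over each member
  separately; bijectivity enters for the column sums.\<close>

lemma magic_unitary_of_partition:
  fixes m' :: "'n::finite \<Rightarrow> 'n \<Rightarrow> 'g star_poly"
  assumes E: "\<And>a. a < m \<Longrightarrow> star (E a) = E a" "(\<Sum>a<m. E a) = 1"
      "\<And>a b. a < m \<Longrightarrow> b < m \<Longrightarrow> E a * E b = (if a = b then E a else 0)"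
    and bij: "\<And>a. a < m \<Longrightarrow> bij (\<sigma> a)"
    and h: "\<And>i j. poly_eval h (m' i j) = (\<Sum>a<m. if \<sigma> a i = j then E a else (0::'a))"
    and r: "r \<in> magic_unitary_rels m'"
  shows "poly_eval h r = 0"
proof -
  let ?P = "\<lambda>i j. \<Sum>a<m. if \<sigma> a i = j then E a else 0"
  have sa: "star (?P i j) = ?P i j" for i j
    unfolding star_sum by (intro sum.cong) (auto simp: E)
  have idem: "?P i j * ?P i j = ?P i j" for i j
  proof -
    have "?P i j * ?P i j = (\<Sum>a<m. \<Sum>b<m. if a = b then if \<sigma> a i = j then E a else 0 else 0)"
      unfolding sum_product by (intro sum.cong) (auto simp: E)
    then show ?thesis by simp
  qed
  have rows: "(\<Sum>j\<in>UNIV. ?P i j) = 1" for i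
    by (subst sum.swap) (simp add: E)
  have cols: "(\<Sum>i\<in>UNIV. ?P i j) = 1" for j
  proof -
    have "(\<Sum>i\<in>UNIV. if \<sigma> a i = j then E a else 0) = E a" if a: "a < m" for a
    proof -
      have "\<sigma> a i = j \<longleftrightarrow> i = inv (\<sigma> a) j" for i
        using bij[OF a] by (metis bij_inv_eq_iff)
      then show ?thesis by simp
    qed
    then show ?thesis by (subst sum.swap) (simp add: E)
  qed
  show ?thesis
    using r unfolding magic_unitary_rels_def projection_rels_def
    by (auto simp: poly_eval_diff poly_eval_star poly_eval_mult poly_eval_sum h sa idem rows cols)
qed

text \<open>Weighted shifts with weights 0 or of modulus 1 are closed under multiplication, so every
  word is again one of them; the empty word is the shift by 0 with weights 1.\<close>

lemma model_word_partial_isometry: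
  "let x = prod_list (map (\<lambda>(i, j). model g i j) ab) in x * star x * x = x"
proof -
  have "\<exists>w k. (\<forall>a. w a * cnj (w a) * w a = w a) \<and>
      prod_list (map (\<lambda>(i, j). model g i j) ab) = shift_op w k"
  proof (induction ab)
    case Nil
    show ?case by (intro exI[of _ "\<lambda>a. 1"] exI[of _ 0]) (simp add: shift_op_one)
  next
    case (Cons p ab)
    then obtain w k where w: "\<forall>a. w a * cnj (w a) * w a = w a"
      "prod_list (map (\<lambda>(i, j). model g i j) ab) = shift_op w k" by blast
    obtain i j where p: "p = (i, j)" by (cases p)
    let ?w = "\<lambda>a. entry (g a) i j * w ((a + 1) mod m)"
    have "?w a * cnj (?w a) * ?w a = ?w a" for a
    proof -
      have "?w a * cnj (?w a) * ?w a = (entry (g a) i j * entry (g a) i j) * entry (g a) i j *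
          (w ((a + 1) mod m) * cnj (w ((a + 1) mod m)) * w ((a + 1) mod m))"
        by (simp add: mult_ac)
      also have "entry (g a) i j * entry (g a) i j * entry (g a) i j = entry (g a) i j"
        by (simp add: entry_def)
      also note w(1)[rule_format, of "(a + 1) mod m"]
      finally show ?thesis .
    qed
    moreover have "prod_list (map (\<lambda>(i, j). model g i j) (p # ab)) = model g i j * shift_op w k"
      by (simp add: p w(2))
    then have "prod_list (map (\<lambda>(i, j). model g i j) (p # ab)) = shift_op ?w (1 + k)"
      unfolding model_def shift_op_mult .
    ultimately show ?case by (intro exI conjI allI)
  qed
  then show ?thesis using shift_op_partial_isometry by (auto simp: Let_def)
qed

text \<open>Signs cancel in the range and source projections, which become partial sums of the
  diagonal units E and of their translates E' respectively. The same permutations index both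
  partitions.\<close>

lemma model_satisfies_relations:
  assumes g: "\<And>a. a < m \<Longrightarrow> g a \<in> signed_perms" and r: "r \<in> quantum_sym_relations"
  shows "poly_eval (\<lambda>(i, j). model g i (j::'n::finite)) r = 0"
proof -
  let ?h = "\<lambda>(i, j). model g i j"
  define E where "E = (\<lambda>a. T a * star (T a))"
  define E' where "E' = (\<lambda>a. E ((a + 1) mod m))"
  have E: "star (E a) = E a" for a by (simp add: E_def star_mult star_star)
  have EE: "E a * E b = (if a = b then E a else 0)" if "a < m" "b < m" for a b
  proof -
    have "E a * E b = T a * (star (T a) * T b) * star (T b)" by (simp add: E_def mult.assoc)
    then show ?thesis using that by (simp add: orth E_def)
  qed
  have EE': "E' a * E' b = (if a = b then E' a else 0)" if "a < m" "b < m" for a b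
    using EE[of "(a + 1) mod m" "(b + 1) mod m"] inj_onD[OF inj_on_shift[of 1], of a b] that m_pos
    by (auto simp: E'_def)
  have sumE: "(\<Sum>a<m. E a) = 1" by (simp add: E_def complete)
  have sumE': "(\<Sum>a<m. E' a) = 1"
    unfolding E'_def using sum.reindex_bij_betw[OF bij_betw_shift[of 1], of E] sumE by simp
  have bij: "bij (fst (g a))" if "a < m" for a using g[OF that] by (auto simp: signed_perms_def)
  have range: "poly_eval ?h (range_poly i j) = (\<Sum>a<m. if fst (g a) i = j then E a else 0)" for i j
    unfolding range_poly_def poly_eval_mult poly_eval_star poly_eval_gen case_prod_conv model_def
      shift_op_mult_star by (intro sum.cong) (auto simp: entry_square E_def)
  have source: "poly_eval ?h (source_poly i j) = (\<Sum>a<m. if fst (g a) i = j then E' a else 0)" for i j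
    unfolding source_poly_def poly_eval_mult poly_eval_star poly_eval_gen case_prod_conv model_def
      star_shift_op_mult by (intro sum.cong) (auto simp: entry_square E_def E'_def)
  have magic_p: "poly_eval ?h r = 0" if "r \<in> magic_unitary_rels range_poly" for r
    by (rule magic_unitary_of_partition[where E = E and \<sigma> = "\<lambda>a. fst (g a)"])
       (use E sumE EE bij range that in auto)
  have magic_q: "poly_eval ?h r = 0" if "r \<in> magic_unitary_rels source_poly" for r
    by (rule magic_unitary_of_partition[where E = E' and \<sigma> = "\<lambda>a. fst (g a)"])
       (use E E'_def sumE' EE' bij source that in auto)
  have partial: "poly_eval ?h (partial_isometry_rel (prod_list (map gen ab))) = 0" for ab
    using model_word_partial_isometry[of g ab]
    by (simp add: partial_isometry_rel_def poly_eval_diff poly_eval_mult poly_eval_star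
        poly_eval_prod_list comp_def Let_def)
  \<comment> \<open>Both sides of the intertwining relation equal 1: one is a column sum of the
    range projections, the other a row sum of the source projections.\<close>
  have "poly_eval ?h (\<Sum>k\<in>UNIV. range_poly k j) = 1" for j
  proof -
    have "(\<Sum>k\<in>UNIV. range_poly k j) - 1 \<in> magic_unitary_rels range_poly"
      by (auto simp: magic_unitary_rels_def)
    from magic_p[OF this] show ?thesis by (simp add: poly_eval_diff)
  qed
  moreover have "poly_eval ?h (\<Sum>k\<in>UNIV. source_poly i k) = 1" for i
  proof -
    have "(\<Sum>k\<in>UNIV. source_poly i k) - 1 \<in> magic_unitary_rels source_poly"
      by (auto simp: magic_unitary_rels_def)
    from magic_q[OF this] show ?thesis by (simp add: poly_eval_diff)
  qed
  ultimately show ?thesis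
    using r magic_p magic_q partial
    by (auto simp: quantum_sym_relations_def poly_eval_diff)
qed

text \<open>Each letter moves one step along the cycle. As \<open>s + length \<alpha> < m\<close>,
  there is no wrap-around, and the coefficients are taken at distinct points, where the matrices can
  be chosen independently.\<close>

lemma star_T_model_word:
  assumes "length \<alpha> = length \<gamma>" "s + length \<alpha> < m"
  shows "star (T s) * prod_list (map2 (model g) \<alpha> \<gamma>)
    = (\<Prod>t<length \<alpha>. entry (g (s + t)) (\<alpha> ! t) (\<gamma> ! t)) *\<^sub>C star (T (s + length \<alpha>))"
  using assms
proof (induction \<alpha> \<gamma> arbitrary: s rule: list_induct2)
  case (Cons i \<alpha> j \<gamma>)
  have "star (T s) * prod_list (map2 (model g) (i # \<alpha>) (j # \<gamma>))
      = (star (T s) * model g i j) * prod_list (map2 (model g) \<alpha> \<gamma>)"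
    by (simp add: mult.assoc)
  also have "\<dots> = entry (g s) i j *\<^sub>C (star (T (Suc s)) * prod_list (map2 (model g) \<alpha> \<gamma>))"
    using Cons.prems by (simp add: model_def star_T_shift_op mult_scaleC_left)
  finally show ?case
    using Cons.IH[of "Suc s"] Cons.prems by (simp add: scaleC_scaleC prod.lessThan_Suc_shift del: prod.lessThan_Suc)
qed simp

text \<open>Starting from 0, the two words end at the points given by their lengths. Both lie below
  m, so orthogonality of the T kills the corner unless the lengths agree. The entries are real,
  hence no conjugates appear.\<close>

lemma model_moment:
  assumes "length \<alpha> = length \<gamma>" "length \<beta> = length \<delta>" "length \<alpha> < m" "length \<beta> < m"
  shows "star (T 0) * (prod_list (map2 (model g) \<alpha> \<gamma>) * star (prod_list (map2 (model g) \<beta> \<delta>))) * T 0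
    = (if length \<alpha> = length \<beta> then
        (\<Prod>t<length \<alpha>. entry (g t) (\<alpha> ! t) (\<gamma> ! t) * entry (g t) (\<beta> ! t) (\<delta> ! t)) *\<^sub>C 1 else 0)"
proof -
  let ?X = "prod_list (map2 (model g) \<alpha> \<gamma>)" and ?Y = "prod_list (map2 (model g) \<beta> \<delta>)"
  have "star (T 0) * (?X * star ?Y) * T 0 = (star (T 0) * ?X) * star (star (T 0) * ?Y)"
    by (simp add: star_mult star_star mult.assoc)
  then show ?thesis
    using star_T_model_word[of \<alpha> \<gamma> 0 g] star_T_model_word[of \<beta> \<delta> 0 g] assms
    by (simp add: star_scaleC star_star mult_scaleC_left mult_scaleC_right scaleC_scaleC orth
        prod.distrib mult.commute)
qed

lemma norm_T: "a < m \<Longrightarrow> norm (T a) = 1"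
  using norm_star_mult_self[of "T a"] norm_ge_zero[of "T a"] by (simp add: orth power2_eq_1_iff)

end

text \<open>The choices at the first n points are independent and factor; each of the other m - n
  points contributes the number of free choices.\<close>

lemma sum_PiE_prod_prefix:
  fixes f :: "'k \<Rightarrow> nat \<Rightarrow> complex"
  assumes "finite K" "n \<le> m"
  shows "(\<Sum>g\<in>{..<m} \<rightarrow>\<^sub>E K. \<Prod>t<n. f (g t) t)
    = (\<Prod>t<n. \<Sum>\<kappa>\<in>K. f \<kappa> t) * of_nat (card K) ^ (m - n)"
proof -
  have split: "(\<Prod>t<m. if t < n then x t else y) = (\<Prod>t<n. x t) * y ^ (m - n)" for x :: "nat \<Rightarrow> complex" and y
  proof -
    have "(\<Prod>t<m. if t < n then x t else y)
        = (\<Prod>t<n. if t < n then x t else y) * (\<Prod>t=n..<m. if t < n then x t else y)"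
      using prod.atLeastLessThan_concat[OF le0 assms(2), of "\<lambda>t. if t < n then x t else y"]
      by (simp only: lessThan_atLeast0)
    then show ?thesis by simp
  qed
  have "(\<Sum>g\<in>{..<m} \<rightarrow>\<^sub>E K. \<Prod>t<n. f (g t) t)
      = (\<Sum>g\<in>{..<m} \<rightarrow>\<^sub>E K. \<Prod>t<m. if t < n then f (g t) t else 1)"
    by (simp add: split)
  also have "\<dots> = (\<Prod>t<m. \<Sum>\<kappa>\<in>K. if t < n then f \<kappa> t else 1)"
    by (rule prod_sum_PiE[symmetric]) (use assms in auto)
  also have "\<dots> = (\<Prod>t<m. if t < n then \<Sum>\<kappa>\<in>K. f \<kappa> t else of_nat (card K))"
    by (intro prod.cong) auto
  finally show ?thesis by (simp add: split)
qed

section \<open>Averaging over the models\<close>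

text \<open>The words of length n serve as T. With at least two letters there are at least 2^n > n
  of them.\<close>

lemma cuntz_tuple_exists:
  fixes S :: "'n::finite \<Rightarrow> 'a::cstar_algebra"
  assumes S: "cuntz_family S" and card: "CARD('n) \<ge> 2"
  obtains m and T :: "nat \<Rightarrow> 'a" where "n < m" "cuntz_tuple m T"
proof -
  let ?L = "{\<alpha>::'n list. length \<alpha> = n}"
  define m where "m = card ?L"
  have "m = CARD('n) ^ n" using card_lists_length_eq[of "UNIV :: 'n set" n] by (simp add: m_def)
  moreover have "2 ^ n \<le> CARD('n) ^ n" using card by (rule power_mono) simp
  moreover have "n < 2 ^ n" by (rule less_exp)
  ultimately have m: "n < m" by linarith
  obtain f where f: "bij_betw f {..<m} ?L"
    using ex_bij_betw_nat_finite[OF finite_lists_of_length, of n]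
    by (auto simp: m_def lessThan_atLeast0)
  have len: "length (f a) = n" if "a < m" for a
    using bij_betw_apply[OF f, of a] that by simp
  have "cuntz_tuple m (\<lambda>a. word S (f a))"
  proof
    fix a b assume ab: "a < m" "b < m"
    then have "f a = f b \<longleftrightarrow> a = b"
      using inj_on_eq_iff[OF bij_betw_imp_inj_on[OF f], of a b] by simp
    then show "star (word S (f a)) * word S (f b) = (if a = b then 1 else 0)"
      using word_orthogonal[OF S, of "f a" "f b"] ab len by simp
  next
    show "(\<Sum>a<m. word S (f a) * star (word S (f a))) = 1"
      using sum.reindex_bij_betw[OF f, of "\<lambda>\<alpha>. word S \<alpha> * star (word S \<alpha>)"] word_complete[OF S]
      by simp
  qed (use m in simp)
  then show thesis using m that by blast
qed

lemma unital_star_hom_prod_list: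
  "unital_star_hom f \<Longrightarrow> f (prod_list xs) = prod_list (map f xs)"
  by (induction xs) (simp_all add: unital_star_hom_def)

lemma unital_star_hom_zero: "unital_star_hom f \<Longrightarrow> f 0 = 0"
  unfolding unital_star_hom_def by (metis add_cancel_right_right)

text \<open>The map \<open>\<Phi>\<close> imitates the Haar state on words of length at most \<open>n\<close>: conjugation by \<open>T 0\<close>
  reads off a corner of each monomial model, and the corners are averaged over all models.\<close>

lemma averaging_map_exists:
  fixes S :: "'n::finite \<Rightarrow> 'a::cstar_algebra" and u :: "'n \<Rightarrow> 'n \<Rightarrow> 'b::cstar_algebra"
  assumes S: "cuntz_family S" and card: "CARD('n) \<ge> 2" and u: "quantum_sym_algebra u"
  obtains \<Phi> :: "'b \<Rightarrow> 'a" and \<tau> :: "'n list \<Rightarrow> complex"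
  where "\<And>b c. \<Phi> (b + c) = \<Phi> b + \<Phi> c" "\<And>z b. \<Phi> (z *\<^sub>C b) = z *\<^sub>C \<Phi> b" "\<Phi> 1 = 1"
    "\<And>b. norm (\<Phi> b) \<le> norm b"
    "\<And>\<alpha> \<beta> \<gamma> \<delta>. length \<gamma> = length \<alpha> \<Longrightarrow> length \<delta> = length \<beta> \<Longrightarrow> length \<alpha> \<le> n \<Longrightarrow> length \<beta> \<le> n \<Longrightarrow>
      \<Phi> (prod_list (map2 u \<alpha> \<gamma>) * star (prod_list (map2 u \<beta> \<delta>)))
        = (if \<alpha> = \<beta> \<and> \<gamma> = \<delta> then \<tau> \<alpha> *\<^sub>C 1 else 0)"
proof -
  obtain m and T :: "nat \<Rightarrow> 'a" where m: "n < m" and T: "cuntz_tuple m T"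
    using cuntz_tuple_exists[OF S card] by blast
  interpret cuntz_tuple m T by (rule T)
  let ?K = "signed_perms :: (('n \<Rightarrow> 'n) \<times> ('n \<Rightarrow> bool)) set"
  \<comment> \<open>C indexes all models: one signed permutation matrix for each of the m
    points.\<close>
  define C where "C = {..<m} \<rightarrow>\<^sub>E ?K"
  have finC: "finite C" unfolding C_def by (intro finite_PiE finite_signed_perms) simp
  have "C \<noteq> {}" by (simp add: C_def PiE_eq_empty_iff signed_perms_nonempty)
  then have C: "card C \<noteq> 0" using finC by simp
  have "\<exists>f :: 'b \<Rightarrow> 'a. unital_star_hom f \<and> (\<forall>i j. f (u i j) = model g i j)" if "g \<in> C" for g
  proof -
    have "\<forall>r\<in>quantum_sym_relations. poly_eval (\<lambda>(i, j). model g i j) r = 0"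
      using that by (intro ballI model_satisfies_relations) (auto simp: C_def)
    from universal_cstar_hom_exists[OF u[unfolded quantum_sym_algebra_def] this]
    show ?thesis by auto
  qed
  then obtain F :: "_ \<Rightarrow> 'b \<Rightarrow> 'a" where
    F: "\<And>g. g \<in> C \<Longrightarrow> unital_star_hom (F g)" "\<And>g i j. g \<in> C \<Longrightarrow> F g (u i j) = model g i j"
    by metis
  define \<Phi> where "\<Phi> b = (1 / of_nat (card C)) *\<^sub>C (\<Sum>g\<in>C. star (T 0) * F g b * T 0)" for b
  \<comment> \<open>This is the averaged moment for \<alpha> = \<beta> and \<gamma> = \<delta>. By
    \<open>sum_entry_products\<close> the column may be replaced by the row index, so \<gamma> does
    not occur.\<close>
  define \<tau> where "\<tau> \<alpha> = (\<Prod>t<length \<alpha>. \<Sum>\<kappa>\<in>?K. entry \<kappa> (\<alpha> ! t) (\<alpha> ! t) * entry \<kappa> (\<alpha> ! t) (\<alpha> ! t))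
      * of_nat (card ?K) ^ (m - length \<alpha>) / of_nat (card C)" for \<alpha>
  show thesis
  proof
    fix b c
    have "F g (b + c) = F g b + F g c" if "g \<in> C" for g
      using F(1)[OF that] by (simp add: unital_star_hom_def)
    then show "\<Phi> (b + c) = \<Phi> b + \<Phi> c"
      by (simp add: \<Phi>_def distrib_left distrib_right sum.distrib scaleC_add_right)
  next
    fix z b
    have "F g (z *\<^sub>C b) = z *\<^sub>C F g b" if "g \<in> C" for g
      using F(1)[OF that] by (simp add: unital_star_hom_def)
    then show "\<Phi> (z *\<^sub>C b) = z *\<^sub>C \<Phi> b"
      by (simp add: \<Phi>_def mult_scaleC_left mult_scaleC_right scaleC_scaleC mult.commute
          flip: scaleC_sum_right)
  next
    have "F g 1 = 1" if "g \<in> C" for g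
      using F(1)[OF that] by (simp add: unital_star_hom_def)
    then have "\<Phi> 1 = (1 / of_nat (card C)) *\<^sub>C (\<Sum>g\<in>C. 1 *\<^sub>C 1)" by (simp add: \<Phi>_def orth m_pos)
    also have "\<dots> = 1" unfolding scaleC_sum_left[symmetric] using C by (simp add: scaleC_scaleC)
    finally show "\<Phi> 1 = 1" .
  next
    fix b
    have "norm (star (T 0) * F g b * T 0) \<le> norm b" if "g \<in> C" for g
    proof -
      have "norm (star (T 0) * F g b * T 0) \<le> norm (star (T 0)) * norm (F g b) * norm (T 0)"
        by (meson mult_right_mono norm_ge_zero norm_mult_ineq order_trans)
      also have "\<dots> = norm (F g b)" by (simp add: norm_star norm_T m_pos)
      also have "\<dots> \<le> norm b" by (rule unital_star_hom_contractive[OF F(1)[OF that]])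
      finally show ?thesis .
    qed
    then have "norm (\<Sum>g\<in>C. star (T 0) * F g b * T 0) \<le> of_nat (card C) * norm b"
      by (rule sum_norm_bound)
    then show "norm (\<Phi> b) \<le> norm b"
      using C by (simp add: \<Phi>_def norm_scaleC norm_divide field_simps)
  next
    fix \<alpha> \<beta> \<gamma> \<delta> :: "'n list"
    assume len: "length \<gamma> = length \<alpha>" "length \<delta> = length \<beta>" "length \<alpha> \<le> n" "length \<beta> \<le> n"
    let ?X = "prod_list (map2 u \<alpha> \<gamma>) * star (prod_list (map2 u \<beta> \<delta>))"
    have FX: "F g ?X = prod_list (map2 (model g) \<alpha> \<gamma>) * star (prod_list (map2 (model g) \<beta> \<delta>))"
      if g: "g \<in> C" for g
    proof -
      have "F g (prod_list (map2 u \<alpha> \<gamma>)) = prod_list (map2 (model g) \<alpha> \<gamma>)" for \<alpha> \<gamma>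
        unfolding unital_star_hom_prod_list[OF F(1)[OF g]]
        by (intro arg_cong[of _ _ prod_list]) (auto simp: F(2)[OF g])
      then show ?thesis using F(1)[OF g] by (simp add: unital_star_hom_def)
    qed
    show "\<Phi> ?X = (if \<alpha> = \<beta> \<and> \<gamma> = \<delta> then \<tau> \<alpha> *\<^sub>C 1 else 0)"
    proof (cases "length \<alpha> = length \<beta>")
      case False
      then have "\<Phi> ?X = 0" using len m by (simp add: \<Phi>_def FX model_moment)
      with False show ?thesis by auto
    next
      case True
      let ?e = "\<lambda>\<kappa> t. entry \<kappa> (\<alpha> ! t) (\<gamma> ! t) * entry \<kappa> (\<beta> ! t) (\<delta> ! t)"
      have "\<Phi> ?X = (1 / of_nat (card C)) *\<^sub>C (\<Sum>g\<in>C. (\<Prod>t<length \<alpha>. ?e (g t) t) *\<^sub>C 1)"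
        using len m True by (simp add: \<Phi>_def FX model_moment)
      also have "\<dots> = ((\<Sum>g\<in>C. \<Prod>t<length \<alpha>. ?e (g t) t) / of_nat (card C)) *\<^sub>C 1"
        by (simp add: scaleC_scaleC flip: scaleC_sum_left)
      also have "(\<Sum>g\<in>C. \<Prod>t<length \<alpha>. ?e (g t) t)
          = (\<Prod>t<length \<alpha>. \<Sum>\<kappa>\<in>?K. ?e \<kappa> t) * of_nat (card ?K) ^ (m - length \<alpha>)"
        unfolding C_def
        by (rule sum_PiE_prod_prefix[OF finite_signed_perms, of _ _ ?e]) (use len m in simp)
      finally have \<Phi>X: "\<Phi> ?X = ((\<Prod>t<length \<alpha>. \<Sum>\<kappa>\<in>?K. ?e \<kappa> t)
          * of_nat (card ?K) ^ (m - length \<alpha>) / of_nat (card C)) *\<^sub>C 1" .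
      show ?thesis
      proof (cases "\<alpha> = \<beta> \<and> \<gamma> = \<delta>")
        case True
        then have "(\<Sum>\<kappa>\<in>?K. ?e \<kappa> t) = (\<Sum>\<kappa>\<in>?K. entry \<kappa> (\<alpha> ! t) (\<alpha> ! t) * entry \<kappa> (\<alpha> ! t) (\<alpha> ! t))" for t
          using sum_entry_products[of "\<alpha> ! t" "\<gamma> ! t" "\<beta> ! t" "\<delta> ! t"] by simp
        then show ?thesis unfolding \<Phi>X \<tau>_def using True by simp
      next
        case False
        \<comment> \<open>One position at which the words disagree already makes a factor of the
          product vanish.\<close>
        then obtain t where t: "t < length \<alpha>" "\<alpha> ! t \<noteq> \<beta> ! t \<or> \<gamma> ! t \<noteq> \<delta> ! t"
          using True len by (metis nth_equalityI)
        then have "(\<Sum>\<kappa>\<in>?K. ?e \<kappa> t) = 0"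
          using sum_entry_products[of "\<alpha> ! t" "\<gamma> ! t" "\<beta> ! t" "\<delta> ! t"] by auto
        then have zero: "(\<Prod>t<length \<alpha>. \<Sum>\<kappa>\<in>?K. ?e \<kappa> t) = 0" using t(1) by (intro prod_zero) auto
        show ?thesis unfolding \<Phi>X zero using False by auto
      qed
    qed
  qed
qed

section \<open>Ergodicity\<close>

text \<open>\<open>slice_rel tens \<omega> \<Phi> t s\<close> says that \<open>s\<close> is a value of \<open>\<Phi> \<otimes> \<omega>\<close> at \<open>t\<close>; the relation is used
  only on the algebraic tensor product, so no extension of \<open>\<Phi> \<otimes> \<omega>\<close> is needed.\<close>

definition slice_rel ::
    "('b \<Rightarrow> 'a \<Rightarrow> 't::cstar_algebra) \<Rightarrow> ('a \<Rightarrow> complex) \<Rightarrow> ('b \<Rightarrow> 'c::cstar_algebra) \<Rightarrow> 't \<Rightarrow> 'c \<Rightarrow> bool" where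
  "slice_rel tens \<omega> \<Phi> t s \<longleftrightarrow>
     (\<exists>xs. t = (\<Sum>(b, a)\<leftarrow>xs. tens b a) \<and> s = (\<Sum>(b, a)\<leftarrow>xs. \<omega> a *\<^sub>C \<Phi> b))"

lemma slice_rel_tens: "slice_rel tens \<omega> \<Phi> (tens b a) (\<omega> a *\<^sub>C \<Phi> b)"
  unfolding slice_rel_def by (intro exI[of _ "[(b, a)]"]) simp

lemma slice_rel_zero: "slice_rel tens \<omega> \<Phi> 0 0"
  unfolding slice_rel_def by (intro exI[of _ "[]"]) simp

lemma slice_rel_add:
  assumes "slice_rel tens \<omega> \<Phi> t s" "slice_rel tens \<omega> \<Phi> t' s'"
  shows "slice_rel tens \<omega> \<Phi> (t + t') (s + s')"
proof -
  obtain xs ys where "t = (\<Sum>(b, a)\<leftarrow>xs. tens b a)" "s = (\<Sum>(b, a)\<leftarrow>xs. \<omega> a *\<^sub>C \<Phi> b)"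
    "t' = (\<Sum>(b, a)\<leftarrow>ys. tens b a)" "s' = (\<Sum>(b, a)\<leftarrow>ys. \<omega> a *\<^sub>C \<Phi> b)"
    using assms by (auto simp: slice_rel_def)
  then show ?thesis unfolding slice_rel_def by (intro exI[of _ "xs @ ys"]) simp
qed

lemma slice_rel_sum:
  "(\<And>i. i \<in> I \<Longrightarrow> slice_rel tens \<omega> \<Phi> (t i) (s i)) \<Longrightarrow> slice_rel tens \<omega> \<Phi> (\<Sum>i\<in>I. t i) (\<Sum>i\<in>I. s i)"
  by (induction I rule: infinite_finite_induct) (simp_all add: slice_rel_zero slice_rel_add)

lemma slice_rel_scale:
  assumes tens: "\<And>c b a. tens (c *\<^sub>C b) a = c *\<^sub>C tens b a"
    and \<Phi>: "\<And>c b. \<Phi> (c *\<^sub>C b) = c *\<^sub>C \<Phi> b" and "slice_rel tens \<omega> \<Phi> t s"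
  shows "slice_rel tens \<omega> \<Phi> (c *\<^sub>C t) (c *\<^sub>C s)"
proof -
  obtain xs where xs: "t = (\<Sum>(b, a)\<leftarrow>xs. tens b a)" "s = (\<Sum>(b, a)\<leftarrow>xs. \<omega> a *\<^sub>C \<Phi> b)"
    using assms(3) by (auto simp: slice_rel_def)
  have "slice_rel tens \<omega> \<Phi> (c *\<^sub>C (\<Sum>(b, a)\<leftarrow>xs. tens b a)) (c *\<^sub>C (\<Sum>(b, a)\<leftarrow>xs. \<omega> a *\<^sub>C \<Phi> b))"
  proof (induction xs)
    case (Cons p xs)
    obtain b a where p: "p = (b, a)" by (cases p)
    have "slice_rel tens \<omega> \<Phi> (tens (c *\<^sub>C b) a) (\<omega> a *\<^sub>C \<Phi> (c *\<^sub>C b))" by (rule slice_rel_tens)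
    then have "slice_rel tens \<omega> \<Phi> (c *\<^sub>C tens b a) (c *\<^sub>C \<omega> a *\<^sub>C \<Phi> b)"
      by (simp add: tens \<Phi> scaleC_scaleC mult.commute)
    from slice_rel_add[OF this Cons] show ?case by (simp add: p scaleC_add_right)
  qed (simp add: slice_rel_zero)
  then show ?thesis unfolding xs .
qed

text \<open>By linearity, s is the value of \<Phi> at the slice of t by \<omega>. Since slicing
  comes first, plain contractivity of \<Phi> suffices.\<close>

lemma slice_rel_norm_le:
  fixes \<Phi> :: "'b::cstar_algebra \<Rightarrow> 'c::cstar_algebra"
  assumes \<Phi>: "\<And>b c. \<Phi> (b + c) = \<Phi> b + \<Phi> c" "\<And>z b. \<Phi> (z *\<^sub>C b) = z *\<^sub>C \<Phi> b"
    "\<And>b. norm (\<Phi> b) \<le> norm b"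
    and slice: "\<And>xs. norm (\<Sum>(b, a)\<leftarrow>xs. \<omega> a *\<^sub>C b) \<le> C * norm (\<Sum>(b, a)\<leftarrow>xs. tens b a)"
    and rel: "slice_rel tens \<omega> \<Phi> t s"
  shows "norm s \<le> C * norm t"
proof -
  obtain xs where xs: "t = (\<Sum>(b, a)\<leftarrow>xs. tens b a)" "s = (\<Sum>(b, a)\<leftarrow>xs. \<omega> a *\<^sub>C \<Phi> b)"
    using rel by (auto simp: slice_rel_def)
  have "\<Phi> 0 = 0" using \<Phi>(2)[of 0 0] by simp
  then have "s = \<Phi> (\<Sum>(b, a)\<leftarrow>xs. \<omega> a *\<^sub>C b)"
    unfolding xs by (induction xs) (auto simp: \<Phi>)
  then have "norm s \<le> norm (\<Sum>(b, a)\<leftarrow>xs. \<omega> a *\<^sub>C b)" using \<Phi>(3) by simp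
  also have "\<dots> \<le> C * norm t" unfolding xs by (rule slice)
  finally show ?thesis .
qed

text \<open>The map sending c to c times 1 is isometric, so its range is complete.\<close>

lemma closed_scalars: "closed (range (\<lambda>c. c *\<^sub>C (1::'a::cstar_algebra)))"
proof -
  have "bounded_linear (\<lambda>c. c *\<^sub>C (1::'a))"
  proof (rule bounded_linear_intro[of _ 1])
    show "(r *\<^sub>R x) *\<^sub>C (1::'a) = r *\<^sub>R x *\<^sub>C 1" for r x
      unfolding scaleR_conv_of_real[of r x] scaleC_scaleC[symmetric] scaleC_of_real ..
  qed (simp_all add: scaleC_add_left norm_scaleC)
  then have "complete ((\<lambda>c. c *\<^sub>C (1::'a)) ` UNIV)"
    by (intro complete_isometric_image[of 1] subspace_UNIV complete_UNIV) (simp_all add: norm_scaleC)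
  then show ?thesis by (rule complete_imp_closed)
qed

lemma minimal_tensor_productD:
  fixes tens :: "'b::cstar_algebra \<Rightarrow> 'a::cstar_algebra \<Rightarrow> 't::cstar_algebra"
  assumes "minimal_tensor_product tens"
  shows "tens (c *\<^sub>C b) a = c *\<^sub>C tens b a" and "tens b (c *\<^sub>C a) = c *\<^sub>C tens b a"
    and "tens b a * tens b' a' = tens (b * b') (a * a')"
    and "star (tens b a) = tens (star b) (star a)" and "tens 1 1 = 1"
    and "\<exists>(\<pi> :: 'b \<Rightarrow> ('b \<Rightarrow> complex) \<Rightarrow> ('b \<Rightarrow> complex)) (\<rho> :: 'a \<Rightarrow> ('a \<Rightarrow> complex) \<Rightarrow> ('a \<Rightarrow> complex)).
        faithful_rep \<pi> \<and> faithful_rep \<rho> \<and>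
        (\<forall>xs. norm (\<Sum>(b, a)\<leftarrow>xs. tens b a) =
              ell2_onorm (\<lambda>f z. \<Sum>(b, a)\<leftarrow>xs. op_tensor (\<pi> b) (\<rho> a) f z))"
proof -
  note t = assms[unfolded minimal_tensor_product_def, THEN conjunct2, THEN conjunct2]
  note t' = t[THEN conjunct2, THEN conjunct2, THEN conjunct2]
  show "tens (c *\<^sub>C b) a = c *\<^sub>C tens b a" and "tens b (c *\<^sub>C a) = c *\<^sub>C tens b a"
    using t[THEN conjunct1] by simp_all
  show "tens b a * tens b' a' = tens (b * b') (a * a')"
    using t[THEN conjunct2, THEN conjunct1] by simp
  show "star (tens b a) = tens (star b) (star a)"
    using t[THEN conjunct2, THEN conjunct2, THEN conjunct1] by simp
  show "tens 1 1 = 1" by (rule t'[THEN conjunct1])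
  show "\<exists>(\<pi> :: 'b \<Rightarrow> ('b \<Rightarrow> complex) \<Rightarrow> ('b \<Rightarrow> complex)) (\<rho> :: 'a \<Rightarrow> ('a \<Rightarrow> complex) \<Rightarrow> ('a \<Rightarrow> complex)).
        faithful_rep \<pi> \<and> faithful_rep \<rho> \<and>
        (\<forall>xs. norm (\<Sum>(b, a)\<leftarrow>xs. tens b a) =
              ell2_onorm (\<lambda>f z. \<Sum>(b, a)\<leftarrow>xs. op_tensor (\<pi> b) (\<rho> a) f z))"
    by (rule t'[THEN conjunct2, THEN conjunct2])
qed

text \<open>The scalar found depends on x and \<Phi> but not on \<omega>. Hence the estimates for
  all vector functionals \<omega> concern one and the same element, and together they bound its
  norm.\<close>

lemma fixed_point_near_scalars:
  fixes S :: "'n::finite \<Rightarrow> 'a::cstar_algebra"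
    and u :: "'n \<Rightarrow> 'n \<Rightarrow> 'b::cstar_algebra"
    and tens :: "'b \<Rightarrow> 'a \<Rightarrow> 't::cstar_algebra"
  assumes card: "CARD('n) \<ge> 2" and S: "cuntz_family S" and u: "quantum_sym_algebra u"
    and tens: "minimal_tensor_product tens" and hom: "unital_star_hom \<phi>"
    and \<phi>: "\<And>i. \<phi> (S i) = (\<Sum>j\<in>UNIV. tens (u i j) (S j))"
    and fixed: "\<phi> a = tens 1 a" and x: "x \<in> word_span S"
  shows "\<exists>\<tau>. norm (\<tau> *\<^sub>C 1 - a) \<le> norm (x - a)"
proof -
  note scale = minimal_tensor_productD(1)[OF tens] and mult = minimal_tensor_productD(3)[OF tens]
    and star = minimal_tensor_productD(4)[OF tens] and one = minimal_tensor_productD(5)[OF tens]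
  obtain \<pi> :: "'b \<Rightarrow> ('b \<Rightarrow> complex) \<Rightarrow> 'b \<Rightarrow> complex" and \<rho> :: "'a \<Rightarrow> ('a \<Rightarrow> complex) \<Rightarrow> 'a \<Rightarrow> complex"
    where \<pi>: "faithful_rep \<pi>" and \<rho>: "faithful_rep \<rho>" and norm_tens: "\<And>xs. norm (\<Sum>(b, a)\<leftarrow>xs. tens b a)
      = ell2_onorm (\<lambda>f z. \<Sum>(b, a)\<leftarrow>xs. op_tensor (\<pi> b) (\<rho> a) f z)"
    using minimal_tensor_productD(6)[OF tens] by blast
  obtain xs where xs: "x = (\<Sum>(c, \<alpha>, \<beta>)\<leftarrow>xs. c *\<^sub>C (word S \<alpha> * star (word S \<beta>)))"
    using x by (auto simp: word_span_def)
  \<comment> \<open>The sum of all lengths is a convenient common bound; it has to be fixed first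
    because \<Phi> depends on it.\<close>
  define n where "n = (\<Sum>(c, \<alpha>, \<beta>)\<leftarrow>xs. length \<alpha> + length \<beta>)"
  have n: "length \<alpha> \<le> n" "length \<beta> \<le> n" if "(c, \<alpha>, \<beta>) \<in> set xs" for c \<alpha> \<beta>
  proof -
    have "length \<alpha> + length \<beta> \<in> set (map (\<lambda>(c, \<alpha>, \<beta>). length \<alpha> + length \<beta>) xs)"
      using that by force
    from member_le_sum_list[OF this] show "length \<alpha> \<le> n" "length \<beta> \<le> n" by (auto simp: n_def)
  qed
  obtain \<Phi> :: "'b \<Rightarrow> 'a" and \<tau> :: "'n list \<Rightarrow> complex"
    where \<Phi>: "\<And>b c. \<Phi> (b + c) = \<Phi> b + \<Phi> c" "\<And>z b. \<Phi> (z *\<^sub>C b) = z *\<^sub>C \<Phi> b" "\<Phi> 1 = 1"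
      "\<And>b. norm (\<Phi> b) \<le> norm b"
      and moment: "\<And>\<alpha> \<beta> \<gamma> \<delta>. length \<gamma> = length \<alpha> \<Longrightarrow> length \<delta> = length \<beta> \<Longrightarrow>
        length \<alpha> \<le> n \<Longrightarrow> length \<beta> \<le> n \<Longrightarrow>
        \<Phi> (prod_list (map2 u \<alpha> \<gamma>) * star (prod_list (map2 u \<beta> \<delta>)))
          = (if \<alpha> = \<beta> \<and> \<gamma> = \<delta> then \<tau> \<alpha> *\<^sub>C 1 else 0)"
    using averaging_map_exists[OF S card u, of n] by blast
  define \<tau>' where "\<tau>' = (\<Sum>(c, \<alpha>, \<beta>)\<leftarrow>xs. if \<alpha> = \<beta> then c * \<tau> \<alpha> else 0)"
  have "norm (\<tau>' *\<^sub>C 1 - a) \<le> norm (x - a)"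
  proof (rule norm_le_of_matrix_coefficients[OF \<rho>])
    fix \<eta> \<xi> :: "'a \<Rightarrow> complex"
    assume \<eta>: "\<eta> \<in> ell2" and \<xi>: "\<xi> \<in> ell2" "ell2_norm \<xi> \<le> 1"
    define \<omega> where "\<omega> = (\<lambda>a. ell2_inner \<eta> (\<rho> a \<xi>))"
    have \<omega>_add: "\<omega> (a + b) = \<omega> a + \<omega> b" and \<omega>_scale: "\<omega> (c *\<^sub>C a) = c * \<omega> a"
      and \<omega>_sum: "\<omega> (\<Sum>i\<in>I. f i) = (\<Sum>i\<in>I. \<omega> (f i))" for a b c and I :: "'n list set" and f
      using \<eta> \<xi> by (simp_all add: \<omega>_def ell2_coefficient_add[OF \<rho>] ell2_coefficient_scale[OF \<rho>]
          ell2_coefficient_sum[OF \<rho>])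
    have \<omega>_diff: "\<omega> (a - b) = \<omega> a - \<omega> b" for a b
      using \<omega>_add[of "a - b" b] by simp
    have word: "slice_rel tens \<omega> \<Phi> (\<phi> (word S \<alpha> * star (word S \<beta>)))
        ((if \<alpha> = \<beta> then \<tau> \<alpha> * \<omega> 1 else 0) *\<^sub>C 1)" if len: "length \<alpha> \<le> n" "length \<beta> \<le> n" for \<alpha> \<beta>
    proof -
      let ?v = "\<lambda>\<gamma> \<delta>. \<omega> (word S \<gamma> * star (word S \<delta>)) *\<^sub>C
        \<Phi> (prod_list (map2 u \<alpha> \<gamma>) * star (prod_list (map2 u \<beta> \<delta>)))"
      have "slice_rel tens \<omega> \<Phi> (\<phi> (word S \<alpha> * star (word S \<beta>)))
          (\<Sum>\<gamma> | length \<gamma> = length \<alpha>. \<Sum>\<delta> | length \<delta> = length \<beta>. ?v \<gamma> \<delta>)"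
        unfolding coaction_word_star_word[where \<phi> = \<phi>, OF hom \<phi> mult one star]
        by (intro slice_rel_sum slice_rel_tens)
      \<comment> \<open>Only \<alpha> = \<beta> and \<gamma> = \<delta> survive. The remaining range
        projections of the words \<gamma> sum to 1 by \<open>word_complete\<close>, which leaves
        \<open>\<omega> 1\<close>.\<close>
      also have "(\<Sum>\<gamma> | length \<gamma> = length \<alpha>. \<Sum>\<delta> | length \<delta> = length \<beta>. ?v \<gamma> \<delta>)
          = (if \<alpha> = \<beta> then \<tau> \<alpha> * \<omega> 1 else 0) *\<^sub>C 1"
      proof (cases "\<alpha> = \<beta>")
        case False
        then show ?thesis using len by (simp add: moment)
      next
        case True
        have "(\<Sum>\<delta> | length \<delta> = length \<beta>. ?v \<gamma> \<delta>)
            = (\<tau> \<alpha> * \<omega> (word S \<gamma> * star (word S \<gamma>))) *\<^sub>C 1" if "length \<gamma> = length \<alpha>" for \<gamma>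
        proof -
          have "(\<Sum>\<delta> | length \<delta> = length \<beta>. ?v \<gamma> \<delta>) = (\<Sum>\<delta> | length \<delta> = length \<beta>.
              if \<delta> = \<gamma> then (\<tau> \<alpha> * \<omega> (word S \<gamma> * star (word S \<gamma>))) *\<^sub>C 1 else 0)"
            using len that True by (intro sum.cong) (auto simp: moment scaleC_scaleC mult.commute)
          then show ?thesis using that True by (simp add: finite_lists_of_length)
        qed
        then have "(\<Sum>\<gamma> | length \<gamma> = length \<alpha>. \<Sum>\<delta> | length \<delta> = length \<beta>. ?v \<gamma> \<delta>)
            = (\<tau> \<alpha> * \<omega> (\<Sum>\<gamma> | length \<gamma> = length \<alpha>. word S \<gamma> * star (word S \<gamma>))) *\<^sub>C 1"
          by (simp add: \<omega>_sum sum_distrib_left scaleC_sum_left)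
        then show ?thesis using True by (simp add: word_complete[OF S])
      qed
      finally show ?thesis .
    qed
    have hom_add: "\<phi> (a + b) = \<phi> a + \<phi> b" and hom_scale: "\<phi> (c *\<^sub>C a) = c *\<^sub>C \<phi> a" for a b c
      using hom by (simp_all add: unital_star_hom_def)
    \<comment> \<open>Passing to lists with entries from xs keeps the length bound n available
      throughout the induction.\<close>
    have "slice_rel tens \<omega> \<Phi> (\<phi> (\<Sum>(c, \<alpha>, \<beta>)\<leftarrow>ys. c *\<^sub>C (word S \<alpha> * star (word S \<beta>))))
        (((\<Sum>(c, \<alpha>, \<beta>)\<leftarrow>ys. if \<alpha> = \<beta> then c * \<tau> \<alpha> else 0) * \<omega> 1) *\<^sub>C 1)" if "set ys \<subseteq> set xs" for ys
      using that
    proof (induction ys)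
      case Nil
      then show ?case by (simp add: unital_star_hom_zero[OF hom] slice_rel_zero)
    next
      case (Cons p ys)
      obtain c \<alpha> \<beta> where p: "p = (c, \<alpha>, \<beta>)" by (cases p)
      then have "(c, \<alpha>, \<beta>) \<in> set xs" using Cons.prems by auto
      note head = slice_rel_scale[where tens = tens, OF scale \<Phi>(2) word[OF n[OF this]], of c]
      have "slice_rel tens \<omega> \<Phi> (\<phi> (\<Sum>(c, \<alpha>, \<beta>)\<leftarrow>ys. c *\<^sub>C (word S \<alpha> * star (word S \<beta>))))
        (((\<Sum>(c, \<alpha>, \<beta>)\<leftarrow>ys. if \<alpha> = \<beta> then c * \<tau> \<alpha> else 0) * \<omega> 1) *\<^sub>C 1)"
        using Cons by simp
      from slice_rel_add[OF head this] show ?case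
        by (cases "\<alpha> = \<beta>")
           (simp_all add: p hom_add hom_scale scaleC_scaleC distrib_right scaleC_add_left mult.assoc)
    qed
    from this[of xs] have "slice_rel tens \<omega> \<Phi> (\<phi> x) ((\<tau>' * \<omega> 1) *\<^sub>C 1)"
      by (simp add: xs \<tau>'_def)
    \<comment> \<open>The factor -1 subtracts the slice of \<open>tens 1 a\<close>, which is
      \<open>\<phi> a\<close> by assumption and has value \<open>\<omega> a\<close> times 1 because
      \<Phi> is unital.\<close>
    from slice_rel_add[OF this slice_rel_scale[where tens = tens and c = "-1",
          OF scale \<Phi>(2) slice_rel_tens[of tens \<omega> \<Phi> 1 a]]]
    have "slice_rel tens \<omega> \<Phi> (\<phi> x - \<phi> a) ((\<tau>' * \<omega> 1) *\<^sub>C 1 - \<omega> a *\<^sub>C 1)"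
      by (simp add: \<Phi>(3) fixed scaleC_left_minus)
    also have "(\<tau>' * \<omega> 1) *\<^sub>C 1 - \<omega> a *\<^sub>C 1 = \<omega> (\<tau>' *\<^sub>C 1 - a) *\<^sub>C (1::'a)"
      using scaleC_add_left[of "\<omega> (\<tau>' *\<^sub>C 1 - a)" "\<omega> a" "1::'a"] by (simp add: \<omega>_diff \<omega>_scale)
    also have "\<phi> x - \<phi> a = \<phi> (x - a)"
      using hom_add[of "x - a" a] by simp
    finally have rel: "slice_rel tens \<omega> \<Phi> (\<phi> (x - a)) (\<omega> (\<tau>' *\<^sub>C 1 - a) *\<^sub>C 1)" .
    have "norm (\<omega> (\<tau>' *\<^sub>C 1 - a) *\<^sub>C (1::'a)) \<le> ell2_norm \<eta> * norm (\<phi> (x - a))"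
    proof (rule slice_rel_norm_le[OF \<Phi>(1,2,4) _ rel])
      show "norm (\<Sum>(b, a)\<leftarrow>xs. \<omega> a *\<^sub>C b) \<le> ell2_norm \<eta> * norm (\<Sum>(b, a)\<leftarrow>xs. tens b a)" for xs
        unfolding norm_tens \<omega>_def by (rule slice_norm_le[OF \<pi> \<rho> \<xi> \<eta>])
    qed
    also have "\<dots> \<le> ell2_norm \<eta> * norm (x - a)"
      by (intro mult_left_mono unital_star_hom_contractive hom ell2_norm_nonneg)
    finally show "cmod (ell2_inner \<eta> (\<rho> (\<tau>' *\<^sub>C 1 - a) \<xi>)) \<le> ell2_norm \<eta> * norm (x - a)"
      by (simp add: norm_scaleC \<omega>_def)
  qed simp
  then show ?thesis by blast
qed

theorem theorem2:
  fixes S :: "'n::finite \<Rightarrow> 'a::cstar_algebra"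
    and u :: "'n \<Rightarrow> 'n \<Rightarrow> 'b::cstar_algebra"
    and tens :: "'b \<Rightarrow> 'a \<Rightarrow> 't::cstar_algebra"
    and \<phi> :: "'a \<Rightarrow> 't"
  assumes "CARD('n) \<ge> 2"
    and "cuntz_algebra S"
    and "quantum_sym_algebra u"
    and "minimal_tensor_product tens"
    and "unital_star_hom \<phi>"
    and "\<And>i. \<phi> (S i) = (\<Sum>j\<in>UNIV. tens (u i j) (S j))"
  shows "{a. \<phi> a = tens 1 a} = range (\<lambda>c. c *\<^sub>C 1)"
proof
  \<comment> \<open>The tensor product supplies the faithful representation from which orthogonality
    of the generators is derived.\<close>
  obtain \<rho> :: "'a \<Rightarrow> ('a \<Rightarrow> complex) \<Rightarrow> 'a \<Rightarrow> complex" where "faithful_rep \<rho>"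
    using minimal_tensor_productD(6)[OF assms(4)] by blast
  with assms(2) have S: "cuntz_family S" by (rule cuntz_algebra_cuntz_family)
  have dense: "closure (range (poly_eval S)) = UNIV"
    using assms(2) by (simp add: cuntz_algebra_def universal_cstar_def)
  show "{a. \<phi> a = tens 1 a} \<subseteq> range (\<lambda>c. c *\<^sub>C 1)"
  proof clarify
    fix a assume a: "\<phi> a = tens 1 a"
    \<comment> \<open>Each *-polynomial near a is replaced by a scalar that is at least as
      near.\<close>
    have "a \<in> closure (range (\<lambda>c. c *\<^sub>C (1::'a)))"
    proof (unfold closure_approachable, intro allI impI)
      fix e :: real assume "e > 0"
      moreover have "a \<in> closure (range (poly_eval S))" using dense by simp
      ultimately obtain p where "dist (poly_eval S p) a < e"
        unfolding closure_approachable by blast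
      moreover obtain c where "norm (c *\<^sub>C 1 - a) \<le> norm (poly_eval S p - a)"
        using fixed_point_near_scalars[OF assms(1) S assms(3-6) a poly_eval_in_word_span[OF S]]
        by blast
      ultimately have "dist (c *\<^sub>C 1) a < e" by (simp add: dist_norm)
      then show "\<exists>y\<in>range (\<lambda>c. c *\<^sub>C 1). dist y a < e" by blast
    qed
    then show "a \<in> range (\<lambda>c. c *\<^sub>C 1)" by (simp only: closure_closed[OF closed_scalars])
  qed
next
  have "\<phi> (c *\<^sub>C 1) = tens 1 (c *\<^sub>C 1)" for c
  proof -
    have "tens 1 (c *\<^sub>C 1) = c *\<^sub>C 1"
      by (simp add: minimal_tensor_productD(2,5)[OF assms(4)])
    moreover have "\<phi> (c *\<^sub>C 1) = c *\<^sub>C 1"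
      using assms(5) by (simp add: unital_star_hom_def)
    ultimately show ?thesis by simp
  qed
  then show "range (\<lambda>c. c *\<^sub>C 1) \<subseteq> {a. \<phi> a = tens 1 a}" by blast
qed

end
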